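(* Let $W_{\psi,\varphi}$ be an unbounded weighted composition operator on $\mathcal F^2$ induced by two entire functions $\varphi,\psi$ with $\psi\not\equiv0$. The following assertions are equivalent. (1) The operator $W_{\psi,\varphi}$ is normal. (2) The operator $W_{\psi,\varphi}$ satisfies both: (a) $W_{\psi,\varphi}=W_{\psi,\varphi,\max}$; (b) one of the following cases occurs, for some complex constants $A,B,C,D$: (i) $\varphi(z)=Az+B$ with $A\ne1$, and $\psi(z)=Ce^{Dz}$, where $D=\overline B(1-A)(1-\overline A)^{-1}$; (ii) $\varphi(z)=z+B$, and $\psi(z)=Ce^{Dz}$, where $|D|=|B|$.
   Context: The Fock space $\mathcal F^2$ is the Hilbert space of entire functions on $\mathbb C$ that are square integrable with respect to $\frac1\pi e^{-|z|^2}\,dV(z)$ ($dV$ is Lebesgue measure on $\mathbb C$), with inner product $\langle f,g\rangle=\frac1\pi\int_{\mathbb C}f(z)\overline{g(z)}e^{-|z|^2}\,dV(z)$. For entire functions $\psi,\varphi$, put $E(\psi,\varphi)f=\psi\cdot (f\circ\varphi)$. The maximal weighted composition operator $W_{\psi,\varphi,\max}$ has domain $\{f\in\mathcal F^2: E(\psi,\varphi)f\in\mathcal F^2\}$ and acts by $W_{\psi,\varphi,\max}f=E(\psi,\varphi)f$. An unbounded weighted composition operator $W_{\psi,\varphi}$ is the restriction of $W_{\psi,\varphi,\max}$ to some linear subspace $\operatorname{dom}(W_{\psi,\varphi})$ of $\operatorname{dom}(W_{\psi,\varphi,\max})$ ("unbounded" means not necessarily bounded). An operator $T$ is normal if it is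 closed, densely defined, $\operatorname{dom}(T)=\operatorname{dom}(T^* )$ and $\|Tx\|=\|T^*x\|$ for all $x\in\operatorname{dom}(T)$. *)

theory Defs
  imports "HOL-Complex_Analysis.Complex_Analysis"
begin

definition fock_space :: "(complex \<Rightarrow> complex) set" where
  "fock_space = {f. f holomorphic_on UNIV \<and>
     integrable lborel (\<lambda>z. (cmod (f z))\<^sup>2 * exp (- (cmod z)\<^sup>2) / pi)}"

definition fock_inner :: "(complex \<Rightarrow> complex) \<Rightarrow> (complex \<Rightarrow> complex) \<Rightarrow> complex" where
  "fock_inner f g = complex_of_real (1 / pi) *
     (LINT z|lborel. f z * cnj (g z) * complex_of_real (exp (- (cmod z)\<^sup>2)))"

definition fock_norm :: "(complex \<Rightarrow> complex) \<Rightarrow> real" where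
  "fock_norm f = sqrt (Re (fock_inner f f))"

definition fock_tendsto ::
  "(nat \<Rightarrow> complex \<Rightarrow> complex) \<Rightarrow> (complex \<Rightarrow> complex) \<Rightarrow> bool" where
  "fock_tendsto F f \<longleftrightarrow> (\<lambda>n. fock_norm (\<lambda>z. F n z - f z)) \<longlonglongrightarrow> 0"

definition linear_subspace :: "(complex \<Rightarrow> complex) set \<Rightarrow> bool" where
  "linear_subspace S \<longleftrightarrow>
     (\<lambda>z. 0) \<in> S \<and>
     (\<forall>f\<in>S. \<forall>g\<in>S. (\<lambda>z. f z + g z) \<in> S) \<and>
     (\<forall>c. \<forall>f\<in>S. (\<lambda>z. c * f z) \<in> S)"

text \<open>
  A not necessarily everywhere defined operator \<open>T\<close> is a partial function whose domain is
  \<open>dom T\<close>, so equality of operators includes equality of their domains.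
\<close>

type_synonym fock_op = "(complex \<Rightarrow> complex) \<rightharpoonup> (complex \<Rightarrow> complex)"

definition densely_defined :: "fock_op \<Rightarrow> bool" where
  "densely_defined T \<longleftrightarrow>
     (\<forall>f\<in>fock_space. \<forall>e>0. \<exists>g\<in>dom T. fock_norm (\<lambda>z. f z - g z) < e)"

definition closed_op :: "fock_op \<Rightarrow> bool" where
  "closed_op T \<longleftrightarrow>
     (\<forall>F f g. (\<forall>n. F n \<in> dom T) \<and> f \<in> fock_space \<and> g \<in> fock_space \<and>
        fock_tendsto F f \<and> fock_tendsto (\<lambda>n. the (T (F n))) g \<longrightarrow> T f = Some g)"

definition adjoint_rel :: "fock_op \<Rightarrow> (complex \<Rightarrow> complex) \<Rightarrow> (complex \<Rightarrow> complex) \<Rightarrow> bool" where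
  "adjoint_rel T g h \<longleftrightarrow> g \<in> fock_space \<and> h \<in> fock_space \<and>
     (\<forall>f\<in>dom T. fock_inner (the (T f)) g = fock_inner f h)"

text \<open>
  The description below is meaningful only for densely defined \<open>T\<close>, where \<open>h\<close> is unique.
\<close>

definition adjoint_op :: "fock_op \<Rightarrow> fock_op" where
  "adjoint_op T g = (if \<exists>h. adjoint_rel T g h then Some (THE h. adjoint_rel T g h) else None)"

definition normal_op :: "fock_op \<Rightarrow> bool" where
  "normal_op T \<longleftrightarrow> closed_op T \<and> densely_defined T \<and> dom T = dom (adjoint_op T) \<and>
     (\<forall>f\<in>dom T. fock_norm (the (T f)) = fock_norm (the (adjoint_op T f)))"

definition wcomp_expr ::
  "(complex \<Rightarrow> complex) \<Rightarrow> (complex \<Rightarrow> complex) \<Rightarrow> (complex \<Rightarrow> complex) \<Rightarrow> complex \<Rightarrow> complex" where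
  "wcomp_expr \<psi> \<phi> f = (\<lambda>z. \<psi> z * f (\<phi> z))"

definition wcomp_max :: "(complex \<Rightarrow> complex) \<Rightarrow> (complex \<Rightarrow> complex) \<Rightarrow> fock_op" where
  "wcomp_max \<psi> \<phi> f =
     (if f \<in> fock_space \<and> wcomp_expr \<psi> \<phi> f \<in> fock_space then Some (wcomp_expr \<psi> \<phi> f) else None)"

definition weighted_composition_op ::
  "(complex \<Rightarrow> complex) \<Rightarrow> (complex \<Rightarrow> complex) \<Rightarrow> fock_op \<Rightarrow> bool" where
  "weighted_composition_op \<psi> \<phi> W \<longleftrightarrow>
     (\<exists>S. linear_subspace S \<and> S \<subseteq> dom (wcomp_max \<psi> \<phi>) \<and> W = wcomp_max \<psi> \<phi> |` S)"

end

theory Submission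
  imports Defs "HOL-Probability.Distributions"
begin

text \<open>
  The reproducing kernels \<open>K\<^sub>u(w) = exp (cnj u * w)\<close> carry the whole argument.

  If \<open>W\<close> is normal, then \<open>K\<^sub>z\<close> lies in the domain of \<open>W\<^sup>*\<close>, hence of \<open>W\<close>, and
  \<open>\<parallel>W K\<^sub>z\<parallel> = \<bar>\<psi>(z)\<bar> exp (\<bar>\<phi>(z)\<bar>\<^sup>2 / 2)\<close>. So \<open>\<psi>\<close> has no zeros, \<open>\<psi> = exp q\<close>, and the pointwise bound
  \<open>\<bar>f(w)\<bar> \<le> \<parallel>f\<parallel> exp (\<bar>w\<bar>\<^sup>2 / 2)\<close> for \<open>f = W K\<^sub>z\<close> bounds the real part of \<open>q + cnj z * \<phi>\<close> by a quadratic
  polynomial. Hence \<open>q\<close> and \<open>\<phi>\<close> are polynomials of degree at most two, and comparing leading terms of the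
  same inequality makes both affine. The norm identity for the kernels then yields the relations between
  \<open>A, B, D\<close>.

  Conversely, let \<open>\<phi>(z) = A z + B\<close> and \<open>\<psi>(z) = C exp (D z)\<close>. On kernels the adjoint of the maximal operator
  acts as the maximal operator with symbols \<open>cnj A * z + cnj D\<close> and \<open>cnj C * exp (cnj B * z)\<close>. The two are
  equal because the kernels span a core: a graph vector orthogonal to the kernels comes from \<open>f\<close> with
  \<open>f(u) = - c exp (cnj E * u) f(\<bar>A\<bar>\<^sup>2 u + E)\<close>, \<open>c > 0\<close>, and such an \<open>f\<close> in the Fock space vanishes. The
  relations between \<open>A, B, D\<close> make the two operators differ by a rigid motion of the plane only, so their
  domains and norms agree. A normal restriction of a normal operator is the operator itself.
\<close>

section \<open>Orthogonal projection\<close>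

text \<open>A minimising sequence for the distance from \<open>x\<close> to \<open>N\<close> is
  Cauchy by the parallelogram law. Its limit attains the infimum, and minimality along the lines
  \<open>p + t *\<^sub>R y\<close> forces orthogonality.\<close>

lemma closed_subspace_projection:
  fixes N :: "'a::{real_inner,complete_space} set"
  assumes "closed N" "subspace N"
  obtains p where "p \<in> N" "\<And>y. y \<in> N \<Longrightarrow> (x - p) \<bullet> y = 0"
proof -
  have ne: "N \<noteq> {}" using subspace_0[OF assms(2)] by auto
  define d where "d = (INF y\<in>N. (norm (x - y))\<^sup>2)"
  have bdd: "bdd_below ((\<lambda>y. (norm (x - y))\<^sup>2) ` N)"
    by (rule bdd_belowI2[of _ 0]) simp
  have d_le: "d \<le> (norm (x - y))\<^sup>2" if "y \<in> N" for y
    unfolding d_def using bdd that by (rule cINF_lower)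
  have "\<exists>y\<in>N. (norm (x - y))\<^sup>2 < d + inverse (real (Suc n))" for n
    using cINF_less_iff[OF ne bdd, of "d + inverse (real (Suc n))"]
    unfolding d_def by simp
  then obtain s where s: "\<And>n. s n \<in> N" "\<And>n. (norm (x - s n))\<^sup>2 < d + inverse (real (Suc n))"
    by metis
  have close: "(norm (s m - s n))\<^sup>2 \<le> 2 * inverse (real (Suc m)) + 2 * inverse (real (Suc n))" for m n
  proof -
    have "(1/2) *\<^sub>R (s m + s n) \<in> N"
      using s(1) assms(2) by (simp add: subspace_add subspace_scale)
    from d_le[OF this] have "4 * d \<le> (norm (2 *\<^sub>R (x - (1/2) *\<^sub>R (s m + s n))))\<^sup>2"
      by (simp add: power_mult_distrib)
    also have "2 *\<^sub>R (x - (1/2) *\<^sub>R (s m + s n)) = (x - s m) + (x - s n)"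
      by (simp add: algebra_simps scaleR_2)
    finally have 1: "4 * d \<le> (norm ((x - s m) + (x - s n)))\<^sup>2" .
    have "(norm ((x - s m) + (x - s n)))\<^sup>2 + (norm ((x - s n) - (x - s m)))\<^sup>2
       = 2 * (norm (x - s m))\<^sup>2 + 2 * (norm (x - s n))\<^sup>2"
      by (simp add: power2_norm_eq_inner algebra_simps inner_commute)
    with 1 s(2)[of m] s(2)[of n] show ?thesis by simp
  qed
  have "Cauchy s"
  proof (rule metric_CauchyI)
    fix e :: real assume "e > 0"
    then obtain M where M: "inverse (real (Suc M)) < e\<^sup>2 / 4"
      using reals_Archimedean[of "e\<^sup>2 / 4"] by auto
    have "dist (s m) (s n) < e" if "m \<ge> M" "n \<ge> M" for m n
    proof -
      have "inverse (real (Suc m)) \<le> inverse (real (Suc M))" "inverse (real (Suc n)) \<le> inverse (real (Suc M))"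
        using that by (auto intro!: le_imp_inverse_le)
      with close[of m n] M have "(norm (s m - s n))\<^sup>2 < e\<^sup>2" by linarith
      then show ?thesis using \<open>e > 0\<close> by (simp add: dist_norm power_less_imp_less_base)
    qed
    then show "\<exists>M. \<forall>m\<ge>M. \<forall>n\<ge>M. dist (s m) (s n) < e" by blast
  qed
  then obtain p where p: "s \<longlonglongrightarrow> p" using Cauchy_convergent convergent_def by blast
  have pN: "p \<in> N" using closed_sequentially[OF assms(1)] s(1) p by blast
  have pd: "(norm (x - p))\<^sup>2 \<le> d"
  proof (rule LIMSEQ_le)
    show "(\<lambda>n. (norm (x - s n))\<^sup>2) \<longlonglongrightarrow> (norm (x - p))\<^sup>2" by (intro tendsto_intros p)
    show "(\<lambda>n. d + inverse (real (Suc n))) \<longlonglongrightarrow> d" using LIMSEQ_inverse_real_of_nat_add by simp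
    show "\<exists>N. \<forall>n\<ge>N. (norm (x - s n))\<^sup>2 \<le> d + inverse (real (Suc n))"
      using s(2) less_imp_le by blast
  qed
  have "(x - p) \<bullet> y = 0" if y: "y \<in> N" for y
  proof (cases "y = 0")
    case False
    \<comment> \<open>This \<open>t\<close> minimises the distance from \<open>x\<close> to the
      points of the line \<open>p + t *\<^sub>R y\<close>.\<close>
    define t where "t = ((x - p) \<bullet> y) / (y \<bullet> y)"
    have yy: "y \<bullet> y > 0" using False by simp
    have "p + t *\<^sub>R y \<in> N" using pN y assms(2) by (simp add: subspace_add subspace_scale)
    from d_le[OF this] pd have "(norm (x - p))\<^sup>2 \<le> (norm ((x - p) - t *\<^sub>R y))\<^sup>2"
      unfolding diff_diff_eq by linarith
    also have "\<dots> = (norm (x - p))\<^sup>2 - 2 * t * ((x - p) \<bullet> y) + t\<^sup>2 * (y \<bullet> y)"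
      unfolding power2_norm_eq_inner
      by (simp add: inner_diff_left inner_diff_right inner_commute algebra_simps power2_eq_square)
    also have "t\<^sup>2 * (y \<bullet> y) = t * ((x - p) \<bullet> y)"
      using yy by (simp add: t_def power2_eq_square)
    finally have "t * ((x - p) \<bullet> y) \<le> 0" by simp
    then have "((x - p) \<bullet> y)\<^sup>2 \<le> 0"
      using yy by (simp add: t_def power2_eq_square divide_le_0_iff zero_less_mult_iff not_less)
    then show ?thesis by simp
  qed simp
  with pN show thesis by (rule that)
qed

lemma subspace_closure:
  fixes S :: "'a::real_normed_vector set"
  assumes "subspace S"
  shows "subspace (closure S)"
proof (rule subspaceI)
  show "0 \<in> closure S" using closure_subset subspace_0[OF assms] by blast
  fix x y assume "x \<in> closure S" "y \<in> closure S"
  then obtain X Y where XY: "\<And>n. X n \<in> S" "X \<longlonglongrightarrow> x" "\<And>n. Y n \<in> S" "Y \<longlonglongrightarrow> y"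
    unfolding closure_sequential by blast
  then have "(\<lambda>n. X n + Y n) \<longlonglongrightarrow> x + y" "\<And>n. X n + Y n \<in> S"
    using assms by (auto intro: tendsto_add subspace_add)
  then show "x + y \<in> closure S" unfolding closure_sequential by (intro exI[of _ "\<lambda>n. X n + Y n"]) auto
next
  fix x and c :: real assume "x \<in> closure S"
  then obtain X where X: "\<And>n. X n \<in> S" "X \<longlonglongrightarrow> x"
    unfolding closure_sequential by blast
  then have "(\<lambda>n. c *\<^sub>R X n) \<longlonglongrightarrow> c *\<^sub>R x" "\<And>n. c *\<^sub>R X n \<in> S"
    using assms by (auto intro: tendsto_scaleR subspace_scale)
  then show "c *\<^sub>R x \<in> closure S" unfolding closure_sequential by (intro exI[of _ "\<lambda>n. c *\<^sub>R X n"]) auto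
qed

text \<open>The residual of the projection of \<open>x\<close> onto \<open>closure (span T)\<close>
  stays in \<open>M\<close> and is orthogonal to \<open>T\<close>, hence vanishes. With
  \<open>M\<close> a graph this yields a core, with \<open>M\<close> the whole space a dense
  set.\<close>

lemma subset_closure_span_if_orthogonal_trivial:
  fixes M T :: "'a::{real_inner,complete_space} set"
  assumes "closed M" "subspace M" "T \<subseteq> M"
    and triv: "\<And>x. \<lbrakk>x \<in> M; \<And>t. t \<in> T \<Longrightarrow> x \<bullet> t = 0\<rbrakk> \<Longrightarrow> x = 0"
  shows "M \<subseteq> closure (span T)"
proof
  fix x assume x: "x \<in> M"
  obtain p where p: "p \<in> closure (span T)" "\<And>y. y \<in> closure (span T) \<Longrightarrow> (x - p) \<bullet> y = 0"
    using closed_subspace_projection[of "closure (span T)" x] subspace_closure by auto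
  have "span T \<subseteq> M" using assms by (simp add: span_minimal)
  then have "closure (span T) \<subseteq> M" using assms(1) by (simp add: closure_minimal)
  then have "x - p \<in> M" using x p(1) assms(2) by (auto intro: subspace_diff)
  moreover have "t \<in> closure (span T)" if "t \<in> T" for t
    using that by (meson closure_subset span_base subsetD)
  ultimately have "x - p = 0" using p(2) triv by blast
  then show "x \<in> closure (span T)" using p(1) by simp
qed

section \<open>Lebesgue measure on the complex plane\<close>

lemma lborel_complex_eq_distr: "(lborel :: complex measure) = distr (lborel \<Otimes>\<^sub>M lborel) borel (\<lambda>(x, y). Complex x y)"
proof (rule lborel_eqI)
  have meas: "(\<lambda>(x, y). Complex x y) \<in> borel_measurable (lborel \<Otimes>\<^sub>M lborel)"
    by (simp add: lborel_prod, intro borel_measurable_continuous_onI) (auto simp: case_prod_beta Complex_eq intro!: continuous_intros)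
  fix l u :: complex assume le: "\<And>b. b \<in> Basis \<Longrightarrow> l \<bullet> b \<le> u \<bullet> b"
  have "Re l \<le> Re u" "Im l \<le> Im u" using le[of 1] le[of \<i>] by (auto simp: Basis_complex_def)
  have "(\<lambda>(x, y). Complex x y) -` box l u \<inter> space (lborel \<Otimes>\<^sub>M lborel) = box (Re l) (Re u) \<times> box (Im l) (Im u)"
    by (auto simp: box_def Basis_complex_def space_pair_measure)
  then show "emeasure (distr (lborel \<Otimes>\<^sub>M lborel) borel (\<lambda>(x, y). Complex x y)) (box l u) = (\<Prod>b\<in>Basis. (u - l) \<bullet> b)"
    using \<open>Re l \<le> Re u\<close> \<open>Im l \<le> Im u\<close>
    by (simp add: emeasure_distr meas lborel.emeasure_pair_measure_Times Basis_complex_def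
        flip: ennreal_mult)
qed simp

lemma nn_integral_lborel_complex:
  assumes [measurable]: "f \<in> borel_measurable (borel :: complex measure)"
  shows "(\<integral>\<^sup>+z. f z \<partial>lborel) = (\<integral>\<^sup>+x. \<integral>\<^sup>+y. f (Complex x y) \<partial>lborel \<partial>lborel)"
    and "(\<integral>\<^sup>+z. f z \<partial>lborel) = (\<integral>\<^sup>+y. \<integral>\<^sup>+x. f (Complex x y) \<partial>lborel \<partial>lborel)"
proof -
  have meas[measurable]: "(\<lambda>(x, y). Complex x y) \<in> borel_measurable (lborel \<Otimes>\<^sub>M lborel)"
    by (simp add: lborel_prod, intro borel_measurable_continuous_onI) (auto simp: case_prod_beta Complex_eq intro!: continuous_intros)
  have *: "(\<integral>\<^sup>+z. f z \<partial>lborel) = (\<integral>\<^sup>+(x,y). f (Complex x y) \<partial>(lborel \<Otimes>\<^sub>M lborel))"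
    by (subst lborel_complex_eq_distr) (subst nn_integral_distr[OF meas], auto simp: case_prod_beta')
  have m: "(\<lambda>(x,y). f (Complex x y)) \<in> borel_measurable (lborel \<Otimes>\<^sub>M lborel)"
    using measurable_compose[OF meas, of f borel] assms by (simp add: case_prod_beta')
  show "(\<integral>\<^sup>+z. f z \<partial>lborel) = (\<integral>\<^sup>+x. \<integral>\<^sup>+y. f (Complex x y) \<partial>lborel \<partial>lborel)"
    using lborel.nn_integral_fst[OF m] * by simp
  show "(\<integral>\<^sup>+z. f z \<partial>lborel) = (\<integral>\<^sup>+y. \<integral>\<^sup>+x. f (Complex x y) \<partial>lborel \<partial>lborel)"
    using lborel_pair.nn_integral_snd[OF m] * by simp
qed

lemma nn_integral_lborel_shear_Re:
  assumes [measurable]: "f \<in> borel_measurable (borel :: complex measure)"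
  shows "(\<integral>\<^sup>+z. f (Complex (Re z + t * Im z) (Im z)) \<partial>lborel) = (\<integral>\<^sup>+z. f z \<partial>lborel)"
proof -
  have m: "(\<lambda>z. f (Complex (Re z + t * Im z) (Im z))) \<in> borel_measurable borel"
    by (intro measurable_compose[OF _ assms] borel_measurable_continuous_onI) (auto simp: Complex_eq intro!: continuous_intros)
  have "(\<integral>\<^sup>+x. f (Complex (x + t * y) y) \<partial>lborel) = (\<integral>\<^sup>+x. f (Complex x y) \<partial>lborel)" for y
  proof -
    have "(\<lambda>x. f (Complex x y)) \<in> borel_measurable borel"
      by (intro measurable_compose[OF _ assms] borel_measurable_continuous_onI) (auto simp: Complex_eq intro!: continuous_intros)
    from nn_integral_real_affine[OF this, of 1 "t * y"] show ?thesis by (simp add: add.commute)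
  qed
  then show ?thesis
    by (simp add: nn_integral_lborel_complex(2)[OF m] nn_integral_lborel_complex(2)[OF assms])
qed

lemma nn_integral_lborel_shear_Im:
  assumes [measurable]: "f \<in> borel_measurable (borel :: complex measure)"
  shows "(\<integral>\<^sup>+z. f (Complex (Re z) (Im z + t * Re z)) \<partial>lborel) = (\<integral>\<^sup>+z. f z \<partial>lborel)"
proof -
  have m: "(\<lambda>z. f (Complex (Re z) (Im z + t * Re z))) \<in> borel_measurable borel"
    by (intro measurable_compose[OF _ assms] borel_measurable_continuous_onI) (auto simp: Complex_eq intro!: continuous_intros)
  have "(\<integral>\<^sup>+y. f (Complex x (y + t * x)) \<partial>lborel) = (\<integral>\<^sup>+y. f (Complex x y) \<partial>lborel)" for x
  proof -
    have "(\<lambda>y. f (Complex x y)) \<in> borel_measurable borel"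
      by (intro measurable_compose[OF _ assms] borel_measurable_continuous_onI) (auto simp: Complex_eq intro!: continuous_intros)
    from nn_integral_real_affine[OF this, of 1 "t * x"] show ?thesis by (simp add: add.commute)
  qed
  then show ?thesis
    by (simp add: nn_integral_lborel_complex(1)[OF m] nn_integral_lborel_complex(1)[OF assms])
qed

lemma nn_integral_lborel_rotate:
  assumes f[measurable]: "f \<in> borel_measurable (borel :: complex measure)" and a: "cmod a = 1"
  shows "(\<integral>\<^sup>+z. f (a * z) \<partial>lborel) = (\<integral>\<^sup>+z. f z \<partial>lborel)"
proof -
  have *: "(\<integral>\<^sup>+z. f (a * z) \<partial>lborel) = (\<integral>\<^sup>+z. f z \<partial>lborel)"
    if [measurable]: "f \<in> borel_measurable (borel :: complex measure)" and a: "cmod a = 1" and ne: "Re a \<noteq> -1" for f a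
  \<comment> \<open>A rotation by an angle other than \<open>\<pi>\<close> is a product of three shears.\<close>
  proof -
    define c s where "c = Re a" and "s = Im a"
    \<comment> \<open>For rotation angle \<theta> this is minus the tangent of \<theta>/2, the
      parameter of the outer two shears; the middle shear has parameter \<open>s\<close>.\<close>
    define t where "t = - s / (1 + c)"
    have cs: "c\<^sup>2 + s\<^sup>2 = 1" using a by (simp add: c_def s_def cmod_def)
    have c1: "1 + c \<noteq> 0" using ne by (auto simp: c_def add_eq_0_iff)
    define g where "g = (\<lambda>z. f (Complex (Re z + t * Im z) (Im z)))"
    define h where "h = (\<lambda>z. g (Complex (Re z) (Im z + s * Re z)))"
    have g[measurable]: "g \<in> borel_measurable borel" unfolding g_def
      by (intro measurable_compose[OF _ that(1)] borel_measurable_continuous_onI) (auto simp: Complex_eq intro!: continuous_intros)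
    have h[measurable]: "h \<in> borel_measurable borel" unfolding h_def
      by (intro measurable_compose[OF _ g] borel_measurable_continuous_onI) (auto simp: Complex_eq intro!: continuous_intros)
    have "t * s = c - 1"
    proof -
      have "s * s = (1 - c) * (1 + c)" using cs by (simp add: power2_eq_square algebra_simps)
      then show ?thesis using c1 by (simp add: t_def field_simps)
    qed
    have ts: "s * t = c - 1" "t * (1 + c) = - s" using \<open>t * s = c - 1\<close> c1 by (simp_all add: t_def mult.commute)
    have "h (Complex (Re z + t * Im z) (Im z)) = f (a * z)" for z
    proof -
      have "Im z + s * (Re z + t * Im z) = Im (a * z)"
      proof -
        have "Im z + s * (Re z + t * Im z) = s * Re z + (1 + s * t) * Im z" by (simp add: algebra_simps)
        then show ?thesis using ts by (simp add: c_def s_def)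
      qed
      moreover have "Re z + t * Im z + t * (Im z + s * (Re z + t * Im z)) = Re (a * z)"
      proof -
        have "Re z + t * Im z + t * (Im z + s * (Re z + t * Im z))
            = (1 + s * t) * Re z + (t * (1 + (1 + s * t))) * Im z" by (simp add: algebra_simps)
        then show ?thesis using ts by (simp add: c_def s_def)
      qed
      ultimately have "Complex (Re z + t * Im z + t * (Im z + s * (Re z + t * Im z))) (Im z + s * (Re z + t * Im z)) = a * z"
        by (simp only: complex_surj)
      then show ?thesis by (simp add: h_def g_def)
    qed
    then have "(\<integral>\<^sup>+z. f (a * z) \<partial>lborel) = (\<integral>\<^sup>+z. h (Complex (Re z + t * Im z) (Im z)) \<partial>lborel)" by simp
    also have "\<dots> = (\<integral>\<^sup>+z. h z \<partial>lborel)" by (rule nn_integral_lborel_shear_Re[OF h])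
    also have "\<dots> = (\<integral>\<^sup>+z. g z \<partial>lborel)" unfolding h_def by (rule nn_integral_lborel_shear_Im[OF g])
    also have "\<dots> = (\<integral>\<^sup>+z. f z \<partial>lborel)" unfolding g_def by (rule nn_integral_lborel_shear_Re[OF that(1)])
    finally show ?thesis .
  qed
  show ?thesis
  proof (cases "Re a = -1")
    case True
    then have "Im a = 0" using a by (simp add: cmod_def)
    with True have "a = -1" by (simp add: complex_eq_iff)
    \<comment> \<open>The half turn is the composition of two quarter turns.\<close>
    then show ?thesis
      using *[of "\<lambda>z. f (\<i> * z)" \<i>] *[of f \<i>] by simp
  qed (use * a f in blast)
qed

lemma lborel_distr_rigid:
  assumes a: "cmod a = 1"
  shows "distr lborel borel (\<lambda>z. a * z + b) = (lborel :: complex measure)"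
proof -
  have rot: "distr lborel borel (\<lambda>z. a * z) = (lborel :: complex measure)"
  proof (rule measure_eqI)
    fix S :: "complex set" assume "S \<in> sets (distr lborel borel (\<lambda>z. a * z))"
    then have S[measurable]: "S \<in> sets borel" by simp
    have "emeasure (distr lborel borel (\<lambda>z. a * z)) S = (\<integral>\<^sup>+z. indicator S z \<partial>distr lborel borel (\<lambda>z. a * z))"
      by simp
    also have "\<dots> = (\<integral>\<^sup>+z. indicator S (a * z) \<partial>lborel)"
      by (subst nn_integral_distr) auto
    also have "\<dots> = emeasure lborel S"
      using nn_integral_lborel_rotate[of "indicator S" a] a by simp
    finally show "emeasure (distr lborel borel (\<lambda>z. a * z)) S = emeasure lborel S" .
  qed simp
  have "distr lborel borel (\<lambda>z. a * z + b) = distr (distr lborel borel (\<lambda>z. a * z)) borel ((+) b)"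
    by (subst distr_distr) (auto simp: comp_def add.commute)
  then show ?thesis by (simp add: rot lborel_distr_plus)
qed

lemma lborel_integral_rigid:
  fixes f :: "complex \<Rightarrow> 'b::{banach,second_countable_topology}"
  assumes "cmod a = 1" and "f \<in> borel_measurable borel"
  shows "(LINT z|lborel. f (a * z + b)) = (LINT z|lborel. f z)"
    and "integrable lborel (\<lambda>z. f (a * z + b)) \<longleftrightarrow> integrable lborel f"
  using integral_distr[of "\<lambda>z. a * z + b" lborel borel f] integrable_distr_eq[of "\<lambda>z. a * z + b" lborel borel f]
    lborel_distr_rigid[OF assms(1), of b] assms(2) by auto

section \<open>The Gaussian integral and mean value properties of entire functions\<close>

lemma has_bochner_integral_gauss_complex:
  "has_bochner_integral lborel (\<lambda>z::complex. exp (- (cmod z)\<^sup>2)) pi"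
proof -
  have half: "(\<integral>\<^sup>+x. ennreal (indicator {0..} x *\<^sub>R exp (- x\<^sup>2)) \<partial>lborel) = ennreal (sqrt pi / 2)"
    using gaussian_moment_0 by (intro nn_integral_eq_integral[THEN trans]) (auto simp: has_bochner_integral_iff)
  have "(\<integral>\<^sup>+x. ennreal (exp (- x\<^sup>2)) \<partial>lborel) = ennreal (sqrt pi)"
  proof -
    have neg: "(\<integral>\<^sup>+x. ennreal (indicator {0..} (-x) *\<^sub>R exp (- x\<^sup>2)) \<partial>lborel) = ennreal (sqrt pi / 2)"
      using nn_integral_real_affine[of "\<lambda>x. ennreal (indicator {0..} x *\<^sub>R exp (- x\<^sup>2))" "-1" 0] half by simp
    \<comment> \<open>The two closed half lines overlap only in the null set {0}.\<close>
    have "(\<integral>\<^sup>+x. ennreal (exp (- x\<^sup>2)) \<partial>lborel)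
       = (\<integral>\<^sup>+x. ennreal (indicator {0..} x *\<^sub>R exp (- x\<^sup>2)) + ennreal (indicator {0..} (-x) *\<^sub>R exp (- x\<^sup>2)) \<partial>lborel)"
      by (rule nn_integral_cong_AE, rule AE_mp[OF AE_lborel_singleton[of 0]]) (auto split: split_indicator)
    also have "\<dots> = ennreal (sqrt pi / 2) + ennreal (sqrt pi / 2)"
      by (subst nn_integral_add) (use half neg in auto)
    also have "\<dots> = ennreal (sqrt pi)" by (simp flip: ennreal_plus)
    finally show ?thesis .
  qed
  then have "(\<Prod>b\<in>(Basis :: complex set). (\<integral>\<^sup>+x. ennreal (exp (- x\<^sup>2)) \<partial>lborel)) = ennreal pi"
    by (simp add: Basis_complex_def flip: ennreal_mult)
  moreover have "(\<integral>\<^sup>+z. (\<Prod>b\<in>(Basis :: complex set). ennreal (exp (- (z \<bullet> b)\<^sup>2))) \<partial>lborel)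
       = (\<Prod>b\<in>(Basis :: complex set). (\<integral>\<^sup>+x. ennreal (exp (- x\<^sup>2)) \<partial>lborel))"
    by (rule nn_integral_lborel_prod) auto
  moreover have "(\<Prod>b\<in>Basis. ennreal (exp (- (z \<bullet> b)\<^sup>2))) = ennreal (exp (- (cmod z)\<^sup>2))" for z :: complex
    by (simp add: Basis_complex_def cmod_power2 exp_diff exp_minus field_simps flip: ennreal_mult)
  ultimately have "(\<integral>\<^sup>+z. ennreal (exp (- (cmod z)\<^sup>2)) \<partial>lborel) = ennreal pi" by simp
  then show ?thesis
    by (intro has_bochner_integral_nn_integral) auto
qed

lemma holomorphic_on_compose_UNIV:
  assumes "f holomorphic_on UNIV" "g holomorphic_on S"
  shows "(\<lambda>z. f (g z)) holomorphic_on S"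
  using holomorphic_on_compose_gen[OF assms(2,1)] by (simp add: comp_def)

lemma complex_gauss_weight: "complex_of_real (exp (- (cmod z)\<^sup>2)) = exp (- (z * cnj z))"
  by (simp flip: complex_norm_square exp_of_real)

text \<open>Cauchy's formula on the unit circle, applied to \<open>\<lambda>u. f (u * w)\<close>.
  Keeping the radius inside the argument covers \<open>w = 0\<close> as well.\<close>

lemma circle_mean_value:
  assumes "f holomorphic_on UNIV"
  shows "(LINT t:{0..1}|lborel. f (exp (2 * of_real pi * \<i> * of_real t) * w)) = f 0"
proof -
  define g where "g = (\<lambda>u. f (u * w))"
  have "g holomorphic_on cball 0 1" unfolding g_def
    by (rule holomorphic_on_compose_UNIV[OF assms]) (intro holomorphic_intros)
  then have "((\<lambda>u. g u / (u - 0)) has_contour_integral (2 * of_real pi * \<i> * g 0)) (circlepath 0 1)"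
    by (rule Cauchy_integral_circlepath_simple) simp
  then have "((\<lambda>t. g (circlepath 0 1 t) / (circlepath 0 1 t) * vector_derivative (circlepath 0 1) (at t within {0..1}))
      has_integral (2 * of_real pi * \<i> * g 0)) {0..1}"
    by (simp add: has_contour_integral_def)
  moreover have "g (circlepath 0 1 t) / (circlepath 0 1 t) * vector_derivative (circlepath 0 1) (at t within {0..1})
      = (2 * of_real pi * \<i>) * g (exp (2 * of_real pi * \<i> * of_real t))" if "t \<in> {0..1}" for t
    using that by (simp add: vector_derivative_circlepath01) (simp add: circlepath)
  ultimately have "((\<lambda>t. (2 * of_real pi * \<i>) * g (exp (2 * of_real pi * \<i> * of_real t)))
      has_integral (2 * of_real pi * \<i> * g 0)) {0..1}"
    by (rule has_integral_eq[rotated])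
  then have "((\<lambda>t. inverse (2 * of_real pi * \<i>) * ((2 * of_real pi * \<i>) * g (exp (2 * of_real pi * \<i> * of_real t))))
      has_integral inverse (2 * of_real pi * \<i>) * (2 * of_real pi * \<i> * g 0)) {0..1}"
    by (rule has_integral_mult_right)
  moreover have "inverse (2 * of_real pi * \<i>) * ((2 * of_real pi * \<i>) * c) = c" for c
    by (simp add: field_simps)
  ultimately have hi: "((\<lambda>t. f (exp (2 * of_real pi * \<i> * of_real t) * w)) has_integral f 0) {0..1}"
    by (simp only: g_def mult_zero_left)
  have cont: "continuous_on {0..1::real} (\<lambda>t. f (exp (2 * of_real pi * \<i> * of_real t) * w))"
    by (intro continuous_on_compose2[OF holomorphic_on_imp_continuous_on[OF assms]] continuous_intros) auto
  then have "set_integrable lborel {0..1} (\<lambda>t. f (exp (2 * of_real pi * \<i> * of_real t) * w))"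
    by (rule borel_integrable_atLeastAtMost')
  from set_borel_integral_eq_integral(2)[OF this] hi show ?thesis
    by (simp add: integral_unique)
qed

text \<open>The weight and Lebesgue measure are rotation invariant, so the integral equals its
  average over all rotations. Exchanging the two integrals lets \<open>circle_mean_value\<close>
  replace \<open>f\<close> by \<open>f 0\<close>; no polar coordinates occur.\<close>

lemma gauss_mean_value:
  assumes hol: "f holomorphic_on UNIV"
    and int: "integrable lborel (\<lambda>z. f z * of_real (exp (- (cmod z)\<^sup>2)))"
  shows "(LINT z|lborel. f z * of_real (exp (- (cmod z)\<^sup>2))) = of_real pi * f 0"
proof -
  define e where "e = (\<lambda>t::real. exp (2 * of_real pi * \<i> * of_real t) :: complex)"
  have e: "cmod (e t) = 1" for t by (simp add: e_def)
  define h where "h = (\<lambda>z. f z * of_real (exp (- (cmod z)\<^sup>2)))"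
  have conth: "continuous_on UNIV h" unfolding h_def
    by (intro continuous_intros holomorphic_on_imp_continuous_on[OF hol])
  then have [measurable]: "h \<in> borel_measurable borel" by (rule borel_measurable_continuous_onI)
  have conte: "continuous_on S e" for S unfolding e_def by (intro continuous_intros)
  have rot: "(LINT z|lborel. h (e t * z)) = (LINT z|lborel. h z)" "integrable lborel (\<lambda>z. h (e t * z))"
    "(LINT z|lborel. norm (h (e t * z))) = (LINT z|lborel. norm (h z))" for t
    using lborel_integral_rigid[OF e, of h t 0] lborel_integral_rigid[OF e, of "\<lambda>z. norm (h z)" t 0] int
    by (simp_all add: h_def)
  define F where "F = (\<lambda>t z. indicator {0..1} t *\<^sub>R h (e t * z))"
  have F: "case_prod F \<in> borel_measurable (lborel \<Otimes>\<^sub>M lborel)"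
  proof -
    have "continuous_on UNIV (\<lambda>p. h (e (fst p) * snd p))"
      by (intro continuous_on_compose2[OF conth] continuous_on_compose2[OF conte] continuous_intros) auto
    then have "(\<lambda>p. h (e (fst p) * snd p)) \<in> borel_measurable borel" by (rule borel_measurable_continuous_onI)
    then have [measurable]: "(\<lambda>p. h (e (fst p) * snd p)) \<in> borel_measurable (lborel \<Otimes>\<^sub>M lborel)"
      by (simp add: lborel_prod)
    show ?thesis unfolding F_def case_prod_beta' by measurable
  qed
  have intF: "integrable (lborel \<Otimes>\<^sub>M lborel) (case_prod F)"
  proof (rule lborel_pair.Fubini_integrable[OF F])
    \<comment> \<open>By rotation invariance the inner integral is constant for \<open>t\<close> in
      the unit interval, which gives the integrability required by Fubini.\<close>
    have "(\<lambda>t. LINT z|lborel. norm (case (t, z) of (t, z) \<Rightarrow> F t z)) = (\<lambda>t. indicator {0..1} t *\<^sub>R (LINT z|lborel. norm (h z)))"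
      by (auto simp: F_def fun_eq_iff rot split: split_indicator)
    then show "integrable lborel (\<lambda>t. LINT z|lborel. norm (case (t, z) of (t, z) \<Rightarrow> F t z))"
      by simp
    show "AE t in lborel. integrable lborel (\<lambda>z. case (t, z) of (t, z) \<Rightarrow> F t z)"
      by (auto simp: F_def rot)
  qed
  have "(LINT z|lborel. h z) = (LINT t:{0..1::real}|lborel. (LINT z|lborel. h z))"
    by (simp add: set_lebesgue_integral_def)
  also have "\<dots> = (LINT t|lborel. LINT z|lborel. F t z)"
    by (simp add: F_def rot set_lebesgue_integral_def)
  also have "\<dots> = (LINT z|lborel. LINT t|lborel. F t z)"
    by (rule lborel_pair.Fubini_integral[OF intF, symmetric])
  also have "\<dots> = (LINT z|lborel. f 0 * of_real (exp (- (cmod z)\<^sup>2)))"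
  proof (rule Bochner_Integration.integral_cong[OF refl])
    fix z
    have "(LINT t|lborel. F t z) = (LINT t:{0..1}|lborel. f (e t * z) * of_real (exp (- (cmod z)\<^sup>2)))"
      unfolding F_def h_def set_lebesgue_integral_def by (simp only: norm_mult e mult_1)
    also have "\<dots> = (LINT t:{0..1}|lborel. f (e t * z)) * of_real (exp (- (cmod z)\<^sup>2))"
      unfolding set_lebesgue_integral_def mult_scaleR_left[symmetric] by (rule integral_mult_left_zero)
    finally show "(LINT t|lborel. F t z) = f 0 * of_real (exp (- (cmod z)\<^sup>2))"
      using circle_mean_value[OF hol, of z] by (simp add: e_def)
  qed
  also have "\<dots> = f 0 * of_real pi"
    using has_bochner_integral_gauss_complex by (simp add: has_bochner_integral_iff)
  finally show ?thesis by (simp add: h_def mult.commute)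
qed

section \<open>The Fock space and its reproducing kernel\<close>

lemma fock_space_holomorphic: "f \<in> fock_space \<Longrightarrow> f holomorphic_on S"
  unfolding fock_space_def using holomorphic_on_subset by blast

lemma fock_space_continuous: "f \<in> fock_space \<Longrightarrow> continuous_on S f"
  by (intro holomorphic_on_imp_continuous_on fock_space_holomorphic)

lemma fock_space_measurable: "f \<in> fock_space \<Longrightarrow> f \<in> borel_measurable borel"
  by (intro borel_measurable_continuous_onI fock_space_continuous)

lemma fock_space_iff:
  "f \<in> fock_space \<longleftrightarrow> f holomorphic_on UNIV \<and> integrable lborel (\<lambda>z. (cmod (f z))\<^sup>2 * exp (- (cmod z)\<^sup>2))"
  unfolding fock_space_def mem_Collect_eq divide_inverse integrable_mult_right_iff by simp

text \<open>A domination test with two dominating functions: \<open>a = b = 2\<close> handles sums,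
  and \<open>b = 0\<close> handles scalar multiples.\<close>

lemma fock_space_weight_bounded:
  assumes "f holomorphic_on UNIV" "f1 \<in> fock_space" "f2 \<in> fock_space"
    and bd: "\<And>z. (cmod (f z))\<^sup>2 \<le> a * (cmod (f1 z))\<^sup>2 + b * (cmod (f2 z))\<^sup>2"
  shows "f \<in> fock_space"
  unfolding fock_space_iff
proof (intro conjI assms)
  have "integrable lborel (\<lambda>z. a * ((cmod (f1 z))\<^sup>2 * exp (- (cmod z)\<^sup>2)) + b * ((cmod (f2 z))\<^sup>2 * exp (- (cmod z)\<^sup>2)))"
    using assms(2,3) by (intro Bochner_Integration.integrable_add integrable_mult_right) (auto simp: fock_space_iff)
  then show "integrable lborel (\<lambda>z. (cmod (f z))\<^sup>2 * exp (- (cmod z)\<^sup>2))"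
  proof (rule Bochner_Integration.integrable_bound)
    show "(\<lambda>z. (cmod (f z))\<^sup>2 * exp (- (cmod z)\<^sup>2)) \<in> borel_measurable lborel"
      unfolding measurable_lborel2
      by (intro borel_measurable_continuous_onI continuous_intros holomorphic_on_imp_continuous_on assms)
    show "AE z in lborel. norm ((cmod (f z))\<^sup>2 * exp (- (cmod z)\<^sup>2))
      \<le> norm (a * ((cmod (f1 z))\<^sup>2 * exp (- (cmod z)\<^sup>2)) + b * ((cmod (f2 z))\<^sup>2 * exp (- (cmod z)\<^sup>2)))"
    proof (intro always_eventually allI)
      fix z
      have "(cmod (f z))\<^sup>2 * exp (- (cmod z)\<^sup>2) \<le> (a * (cmod (f1 z))\<^sup>2 + b * (cmod (f2 z))\<^sup>2) * exp (- (cmod z)\<^sup>2)"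
        by (intro mult_right_mono bd) simp
      then show "norm ((cmod (f z))\<^sup>2 * exp (- (cmod z)\<^sup>2))
      \<le> norm (a * ((cmod (f1 z))\<^sup>2 * exp (- (cmod z)\<^sup>2)) + b * ((cmod (f2 z))\<^sup>2 * exp (- (cmod z)\<^sup>2)))"
        by (simp add: algebra_simps)
    qed
  qed
qed

lemma cmod_add_square_le: "(cmod (a + b))\<^sup>2 \<le> 2 * (cmod a)\<^sup>2 + 2 * (cmod b)\<^sup>2"
proof -
  have "(cmod (a + b))\<^sup>2 \<le> (cmod a + cmod b)\<^sup>2" by (intro power_mono norm_triangle_ineq) simp
  also have "\<dots> \<le> 2 * (cmod a)\<^sup>2 + 2 * (cmod b)\<^sup>2"
    using sum_squares_bound[of "cmod a" "cmod b"] by (simp add: power2_sum)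
  finally show ?thesis .
qed

lemma fock_space_0: "(\<lambda>z. 0) \<in> fock_space"
  by (simp add: fock_space_def)

lemma fock_space_add: "f \<in> fock_space \<Longrightarrow> g \<in> fock_space \<Longrightarrow> (\<lambda>z. f z + g z) \<in> fock_space"
  by (rule fock_space_weight_bounded[of _ f g 2 2]) (auto intro: holomorphic_intros fock_space_holomorphic cmod_add_square_le)

lemma fock_space_cmult: "f \<in> fock_space \<Longrightarrow> (\<lambda>z. c * f z) \<in> fock_space"
  by (rule fock_space_weight_bounded[of _ f f "(cmod c)\<^sup>2" 0])
    (auto intro: holomorphic_intros fock_space_holomorphic simp: norm_mult power_mult_distrib)

lemma fock_space_diff: "f \<in> fock_space \<Longrightarrow> g \<in> fock_space \<Longrightarrow> (\<lambda>z. f z - g z) \<in> fock_space"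
  using fock_space_add[of f "\<lambda>z. (-1) * g z"] fock_space_cmult[of g "-1"] by simp

lemma fock_inner_integrable:
  assumes "f \<in> fock_space" "g \<in> fock_space"
  shows "integrable lborel (\<lambda>z. f z * cnj (g z) * complex_of_real (exp (- (cmod z)\<^sup>2)))"
proof -
  have "integrable lborel (\<lambda>z. (cmod (f z))\<^sup>2 * exp (- (cmod z)\<^sup>2) + (cmod (g z))\<^sup>2 * exp (- (cmod z)\<^sup>2))"
    using assms by (intro Bochner_Integration.integrable_add) (auto simp: fock_space_iff)
  then show ?thesis
  proof (rule Bochner_Integration.integrable_bound)
    show "(\<lambda>z. f z * cnj (g z) * complex_of_real (exp (- (cmod z)\<^sup>2))) \<in> borel_measurable lborel"
      unfolding measurable_lborel2
      by (intro borel_measurable_continuous_onI continuous_intros fock_space_continuous assms)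
    show "AE z in lborel. norm (f z * cnj (g z) * complex_of_real (exp (- (cmod z)\<^sup>2)))
      \<le> norm ((cmod (f z))\<^sup>2 * exp (- (cmod z)\<^sup>2) + (cmod (g z))\<^sup>2 * exp (- (cmod z)\<^sup>2))"
    proof (intro always_eventually allI)
      fix z
      have "0 \<le> cmod (f z) * cmod (g z)" by simp
      then have "cmod (f z) * cmod (g z) \<le> (cmod (f z))\<^sup>2 + (cmod (g z))\<^sup>2"
        using sum_squares_bound[of "cmod (f z)" "cmod (g z)"] by linarith
      then have "(cmod (f z) * cmod (g z)) * exp (- (cmod z)\<^sup>2) \<le> ((cmod (f z))\<^sup>2 + (cmod (g z))\<^sup>2) * exp (- (cmod z)\<^sup>2)"
        by (rule mult_right_mono) simp
      then show "norm (f z * cnj (g z) * complex_of_real (exp (- (cmod z)\<^sup>2)))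
         \<le> norm ((cmod (f z))\<^sup>2 * exp (- (cmod z)\<^sup>2) + (cmod (g z))\<^sup>2 * exp (- (cmod z)\<^sup>2))"
        by (simp add: norm_mult algebra_simps)
    qed
  qed
qed

lemma fock_inner_add_left:
  assumes "f \<in> fock_space" "g \<in> fock_space" "h \<in> fock_space"
  shows "fock_inner (\<lambda>z. f z + g z) h = fock_inner f h + fock_inner g h"
  unfolding fock_inner_def distrib_right
  using assms by (subst Bochner_Integration.integral_add) (auto intro: fock_inner_integrable simp: distrib_left)

lemma fock_inner_cmult_left: "fock_inner (\<lambda>z. c * f z) h = c * fock_inner f h"
  unfolding fock_inner_def mult.assoc integral_mult_right_zero by (rule mult.left_commute)

lemma cnj_fock_inner: "cnj (fock_inner f g) = fock_inner g f"
proof -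
  have "cnj (LINT z|lborel. f z * cnj (g z) * complex_of_real (exp (- (cmod z)\<^sup>2)))
      = (LINT z|lborel. cnj (f z * cnj (g z) * complex_of_real (exp (- (cmod z)\<^sup>2))))"
    by (rule Bochner_Integration.integral_cnj[symmetric])
  then show ?thesis unfolding fock_inner_def by (simp add: mult.commute)
qed

lemma fock_inner_cmult_right: "fock_inner f (\<lambda>z. c * h z) = cnj c * fock_inner f h"
  using fock_inner_cmult_left[of c h f] by (metis cnj_fock_inner complex_cnj_mult)

lemma fock_inner_add_right:
  assumes "f \<in> fock_space" "g \<in> fock_space" "h \<in> fock_space"
  shows "fock_inner h (\<lambda>z. f z + g z) = fock_inner h f + fock_inner h g"
  using fock_inner_add_left[OF assms] by (metis cnj_fock_inner complex_cnj_add)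

lemma fock_inner_self:
  "fock_inner f f = of_real ((LINT z|lborel. (cmod (f z))\<^sup>2 * exp (- (cmod z)\<^sup>2)) / pi)"
proof -
  have "f z * cnj (f z) * complex_of_real (exp (- (cmod z)\<^sup>2)) = of_real ((cmod (f z))\<^sup>2 * exp (- (cmod z)\<^sup>2))" for z
    by (simp add: complex_norm_square[symmetric] del: of_real_power of_real_exp flip: of_real_mult)
  then show ?thesis unfolding fock_inner_def by (simp only: integral_complex_of_real) simp
qed

lemma Re_fock_inner_self_nonneg: "0 \<le> Re (fock_inner f f)"
  unfolding fock_inner_self by (simp add: integral_nonneg_AE)

lemma fock_norm_square: "(fock_norm f)\<^sup>2 = (LINT z|lborel. (cmod (f z))\<^sup>2 * exp (- (cmod z)\<^sup>2)) / pi"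
  unfolding fock_norm_def using Re_fock_inner_self_nonneg[of f] by (simp add: fock_inner_self)

definition fock_kernel :: "complex \<Rightarrow> complex \<Rightarrow> complex" where
  "fock_kernel u = (\<lambda>w. exp (cnj u * w))"

lemma fock_kernel_in_fock_space: "fock_kernel u \<in> fock_space"
  unfolding fock_space_iff
proof
  show "fock_kernel u holomorphic_on UNIV" unfolding fock_kernel_def by (intro holomorphic_intros)
  \<comment> \<open>Completing the square turns the weighted kernel into a translated
    Gaussian.\<close>
  have "(cmod (fock_kernel u w))\<^sup>2 * exp (- (cmod w)\<^sup>2) = exp ((cmod u)\<^sup>2) * exp (- (cmod (1 * w + (- u)))\<^sup>2)" for w
  proof -
    have "(cmod (fock_kernel u w))\<^sup>2 * exp (- (cmod w)\<^sup>2) = exp (2 * Re (cnj u * w) + - (cmod w)\<^sup>2)"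
      unfolding fock_kernel_def norm_exp_eq_Re exp_add exp_double ..
    also have "2 * Re (cnj u * w) + - (cmod w)\<^sup>2 = (cmod u)\<^sup>2 + - (cmod (1 * w + (- u)))\<^sup>2"
      unfolding cmod_power2 by (simp add: power2_eq_square algebra_simps)
    finally show ?thesis by (simp only: exp_add)
  qed
  moreover have "integrable lborel (\<lambda>w. exp (- (cmod (1 * w + (- u)))\<^sup>2))"
    using lborel_integral_rigid(2)[of 1 "\<lambda>z. exp (- (cmod z)\<^sup>2)" "- u"] has_bochner_integral_gauss_complex
    by (simp add: has_bochner_integral_iff)
  ultimately show "integrable lborel (\<lambda>w. (cmod (fock_kernel u w))\<^sup>2 * exp (- (cmod w)\<^sup>2))"
    by simp
qed

text \<open>After the translation \<open>w = v + z\<close> the kernel and the weight combine to the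
  centred Gaussian times an entire factor that equals 1 at \<open>v = 0\<close>. The Gaussian mean
  value property then returns \<open>f z\<close>.\<close>

lemma fock_inner_kernel:
  assumes f: "f \<in> fock_space"
  shows "fock_inner f (fock_kernel z) = f z"
proof -
  define h where "h = (\<lambda>w. f w * cnj (fock_kernel z w) * complex_of_real (exp (- (cmod w)\<^sup>2)))"
  define g where "g = (\<lambda>v. f (v + z) * exp (- cnj z * v))"
  have h: "integrable lborel h" unfolding h_def
    by (intro fock_inner_integrable f fock_kernel_in_fock_space)
  have [measurable]: "h \<in> borel_measurable borel" using borel_measurable_integrable[OF h] by simp
  have eq: "h (1 * v + z) = g v * of_real (exp (- (cmod v)\<^sup>2))" for v
  proof -
    have "cnj (fock_kernel z (v + z)) * complex_of_real (exp (- (cmod (v + z))\<^sup>2))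
       = exp (z * cnj (v + z) + - ((v + z) * cnj (v + z)))"
      unfolding complex_gauss_weight exp_add by (simp add: fock_kernel_def exp_cnj)
    also have "z * cnj (v + z) + - ((v + z) * cnj (v + z)) = - cnj z * v + - (v * cnj v)" by (simp add: algebra_simps)
    also have "exp (- cnj z * v + - (v * cnj v)) = exp (- cnj z * v) * complex_of_real (exp (- (cmod v)\<^sup>2))"
      unfolding complex_gauss_weight exp_add ..
    finally show ?thesis by (simp add: h_def g_def mult.assoc)
  qed
  have "(LINT w|lborel. h w) = (LINT v|lborel. h (1 * v + z))"
    by (rule lborel_integral_rigid(1)[symmetric]) auto
  also have "\<dots> = (LINT v|lborel. g v * of_real (exp (- (cmod v)\<^sup>2)))" by (simp only: eq)
  also have "\<dots> = of_real pi * g 0"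
  proof (rule gauss_mean_value)
    have "(\<lambda>v. f (v + z)) holomorphic_on UNIV"
      by (rule holomorphic_on_compose_UNIV[OF fock_space_holomorphic[OF f]]) (intro holomorphic_intros)
    then show "g holomorphic_on UNIV" unfolding g_def by (intro holomorphic_intros)
    show "integrable lborel (\<lambda>v. g v * complex_of_real (exp (- (cmod v)\<^sup>2)))"
      using lborel_integral_rigid(2)[of 1 h z] h by (simp only: eq) simp
  qed
  finally show ?thesis by (simp add: fock_inner_def h_def g_def)
qed

section \<open>The Fock space as a Hilbert space\<close>

typedef fock = fock_space
  morphisms fock_fun Fock
  using fock_space_0 by blast

setup_lifting type_definition_fock

instantiation fock :: real_inner
begin

lift_definition zero_fock :: fock is "\<lambda>z. 0" by (rule fock_space_0)

lift_definition plus_fock :: "fock \<Rightarrow> fock \<Rightarrow> fock" is "\<lambda>f g z. f z + g z" by (rule fock_space_add)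

lift_definition minus_fock :: "fock \<Rightarrow> fock \<Rightarrow> fock" is "\<lambda>f g z. f z - g z" by (rule fock_space_diff)

lift_definition uminus_fock :: "fock \<Rightarrow> fock" is "\<lambda>f z. - f z"
  using fock_space_cmult[of _ "-1"] by simp

lift_definition scaleR_fock :: "real \<Rightarrow> fock \<Rightarrow> fock" is "\<lambda>r f z. of_real r * f z" by (rule fock_space_cmult)

text \<open>The class \<open>real_inner\<close> demands a real inner product. Complex identities are
  recovered later by testing with complex multiples of a vector, namely with the factors 1 and
  \<i>.\<close>

lift_definition inner_fock :: "fock \<Rightarrow> fock \<Rightarrow> real" is "\<lambda>f g. Re (fock_inner f g)" .

lift_definition norm_fock :: "fock \<Rightarrow> real" is fock_norm .

definition sgn_fock :: "fock \<Rightarrow> fock" where "sgn_fock x = inverse (norm x) *\<^sub>R x"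

definition dist_fock :: "fock \<Rightarrow> fock \<Rightarrow> real" where "dist_fock x y = norm (x - y)"

definition uniformity_fock :: "(fock \<times> fock) filter" where
  "uniformity_fock = (INF e\<in>{0<..}. principal {(x, y). dist x y < e})"

definition open_fock :: "fock set \<Rightarrow> bool" where
  "open_fock U \<longleftrightarrow> (\<forall>x\<in>U. eventually (\<lambda>(x', y). x' = x \<longrightarrow> y \<in> U) uniformity)"

instance
proof
  fix x y z :: fock and r s :: real
  show "x + y + z = x + (y + z)" "x + y = y + x" "0 + x = x" "- x + x = 0" "x - y = x + - y"
    "r *\<^sub>R (x + y) = r *\<^sub>R x + r *\<^sub>R y" "(r + s) *\<^sub>R x = r *\<^sub>R x + s *\<^sub>R x"
    "r *\<^sub>R s *\<^sub>R x = (r * s) *\<^sub>R x" "1 *\<^sub>R x = x"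
    by (transfer, simp add: algebra_simps)+
  show "sgn x = inverse (norm x) *\<^sub>R x" by (rule sgn_fock_def)
  show "dist x y = norm (x - y)" by (rule dist_fock_def)
  show "uniformity = (INF e\<in>{0<..}. principal {(x, y :: fock). dist x y < e})" by (rule uniformity_fock_def)
  show "open U \<longleftrightarrow> (\<forall>x\<in>U. eventually (\<lambda>(x', y). x' = x \<longrightarrow> y \<in> U) uniformity)" for U :: "fock set"
    by (rule open_fock_def)
  show "x \<bullet> y = y \<bullet> x"
    by transfer (metis cnj_fock_inner complex_cnj(1) complex_surj complex.sel(1))
  show "(x + y) \<bullet> z = x \<bullet> z + y \<bullet> z" by transfer (simp add: fock_inner_add_left)
  show "(r *\<^sub>R x) \<bullet> y = r * (x \<bullet> y)" by transfer (simp add: fock_inner_cmult_left)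
  show "0 \<le> x \<bullet> x" by transfer (rule Re_fock_inner_self_nonneg)
  show "norm x = sqrt (x \<bullet> x)" by transfer (simp add: fock_norm_def)
  show "x \<bullet> x = 0 \<longleftrightarrow> x = 0"
  proof
    assume "x \<bullet> x = 0"
    then show "x = 0"
    proof transfer
      fix f assume f: "f \<in> fock_space" and "Re (fock_inner f f) = 0"
      then have "(LINT z|lborel. (cmod (f z))\<^sup>2 * exp (- (cmod z)\<^sup>2)) = 0"
        by (simp add: fock_inner_self)
      then have "AE z in lborel. (cmod (f z))\<^sup>2 * exp (- (cmod z)\<^sup>2) = 0"
        using f by (subst (asm) integral_nonneg_eq_0_iff_AE) (auto simp: fock_space_iff)
      then have ae: "AE z in lborel. f z = 0" by simp
      \<comment> \<open>A vanishing integral gives \<open>f = 0\<close> only almost everywhere; the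
        reproducing property turns this into vanishing at each point.\<close>
      have "f u = 0" for u
      proof -
        have "(LINT z|lborel. f z * cnj (fock_kernel u z) * complex_of_real (exp (- (cmod z)\<^sup>2))) = (LINT z|(lborel :: complex measure). 0)"
          using ae fock_inner_integrable[OF f fock_kernel_in_fock_space, of u]
          by (intro integral_cong_AE) auto
        then show ?thesis using fock_inner_kernel[OF f, of u] by (simp add: fock_inner_def)
      qed
      then show "f = (\<lambda>z. 0)" by blast
    qed
  next
    assume "x = 0"
    then show "x \<bullet> x = 0" by simp (transfer, simp add: fock_inner_def)
  qed
qed

end

section \<open>Norm estimates, point evaluation and completeness\<close>

lemma fock_fun_in [simp]: "fock_fun x \<in> fock_space"
  using fock_fun by simp

lemma fock_fun_Fock [simp]: "f \<in> fock_space \<Longrightarrow> fock_fun (Fock f) = f"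
  by (rule Fock_inverse)

lemma fock_fun_simps [simp]:
  "fock_fun 0 z = 0" "fock_fun (x + y) z = fock_fun x z + fock_fun y z"
  "fock_fun (x - y) z = fock_fun x z - fock_fun y z" "fock_fun (r *\<^sub>R x) z = of_real r * fock_fun x z"
  by (transfer, simp)+

lemma Fock_diff: "f \<in> fock_space \<Longrightarrow> g \<in> fock_space \<Longrightarrow> Fock (\<lambda>z. f z - g z) = Fock f - Fock g"
  by (rule fock_fun_inject[THEN iffD1]) (auto simp: fock_space_diff)

lemma fock_norm_eq_norm: "f \<in> fock_space \<Longrightarrow> fock_norm f = norm (Fock f)"
  by (simp add: norm_fock.rep_eq)

lemma inner_Fock: "f \<in> fock_space \<Longrightarrow> g \<in> fock_space \<Longrightarrow> Fock f \<bullet> Fock g = Re (fock_inner f g)"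
  by (simp add: inner_fock.rep_eq)

lemma fock_norm_cmult: "fock_norm (\<lambda>z. c * f z) = cmod c * fock_norm f"
proof -
  have "fock_inner (\<lambda>z. c * f z) (\<lambda>z. c * f z) = of_real ((cmod c)\<^sup>2) * fock_inner f f"
    unfolding fock_inner_cmult_left fock_inner_cmult_right complex_norm_square by (simp add: mult.assoc)
  then show ?thesis by (simp add: fock_norm_def real_sqrt_mult)
qed

lemma fock_norm_nonneg: "0 \<le> fock_norm f"
  by (simp add: fock_norm_def Re_fock_inner_self_nonneg)

lemma fock_norm_diff_commute:
  "f \<in> fock_space \<Longrightarrow> g \<in> fock_space \<Longrightarrow> fock_norm (\<lambda>z. f z - g z) = fock_norm (\<lambda>z. g z - f z)"
  by (simp add: fock_norm_eq_norm fock_space_diff Fock_diff norm_minus_commute)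

text \<open>Multiplying \<open>f\<close> by a suitable \<open>c\<close> makes the complex inner
  product real and nonnegative, which reduces the claim to the real inequality on
  \<open>fock\<close>.\<close>

lemma fock_Cauchy_Schwarz:
  assumes "f \<in> fock_space" "g \<in> fock_space"
  shows "cmod (fock_inner f g) \<le> fock_norm f * fock_norm g"
proof -
  define c where "c = cnj (sgn (fock_inner f g))"
  have "c * fock_inner f g = of_real (cmod (fock_inner f g))"
    by (cases "fock_inner f g = 0")
      (simp_all add: c_def sgn_eq complex_norm_square[symmetric] mult.commute power2_eq_square field_simps)
  then have "cmod (fock_inner f g) = Re (fock_inner (\<lambda>z. c * f z) g)"
    by (simp add: fock_inner_cmult_left)
  also have "\<dots> = Fock (\<lambda>z. c * f z) \<bullet> Fock g"
    using assms by (simp add: inner_Fock fock_space_cmult)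
  also have "\<dots> \<le> norm (Fock (\<lambda>z. c * f z)) * norm (Fock g)" by (rule norm_cauchy_schwarz)
  also have "\<dots> = cmod c * fock_norm f * fock_norm g"
    using assms by (simp add: fock_space_cmult flip: fock_norm_eq_norm) (simp add: fock_norm_cmult)
  \<comment> \<open>Only an inequality, because \<open>c = 0\<close> when the inner product
    vanishes.\<close>
  also have "\<dots> \<le> 1 * fock_norm f * fock_norm g"
    by (intro mult_right_mono fock_norm_nonneg) (simp add: c_def norm_sgn)
  finally show ?thesis by simp
qed

lemma fock_norm_kernel: "fock_norm (fock_kernel u) = exp ((cmod u)\<^sup>2 / 2)"
proof -
  have "fock_inner (fock_kernel u) (fock_kernel u) = of_real (exp ((cmod u)\<^sup>2))"
    unfolding fock_inner_kernel[OF fock_kernel_in_fock_space]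
    by (simp add: fock_kernel_def mult.commute flip: complex_norm_square exp_of_real)
  moreover have "exp ((cmod u)\<^sup>2) = (exp ((cmod u)\<^sup>2 / 2))\<^sup>2" by (simp flip: exp_double)
  ultimately show ?thesis by (simp add: fock_norm_def)
qed

text \<open>Evaluation at \<open>z\<close> is pairing with \<open>fock_kernel z\<close>, so its size
  is governed by the norm of that kernel. Norm limits thereby become pointwise limits.\<close>

lemma fock_pointwise_le:
  assumes "f \<in> fock_space"
  shows "cmod (f z) \<le> fock_norm f * exp ((cmod z)\<^sup>2 / 2)"
  using fock_Cauchy_Schwarz[OF assms fock_kernel_in_fock_space[of z]]
  by (simp add: fock_inner_kernel assms fock_norm_kernel)

lemma fock_norm_eq_0: "f \<in> fock_space \<Longrightarrow> fock_norm f = 0 \<Longrightarrow> f z = 0"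
  using fock_pointwise_le[of f z] by simp

lemma nn_integral_fock_norm:
  assumes "f \<in> fock_space"
  shows "(\<integral>\<^sup>+z. ennreal ((cmod (f z))\<^sup>2 * exp (- (cmod z)\<^sup>2)) \<partial>lborel) = ennreal (pi * (fock_norm f)\<^sup>2)"
  using assms by (subst nn_integral_eq_integral) (auto simp: fock_space_iff fock_norm_square)

text \<open>Carries membership and a norm bound over to an entire pointwise limit, which is what
  completeness requires.\<close>

lemma fock_Fatou:
  assumes "\<And>n. G n \<in> fock_space" "g holomorphic_on UNIV"
    and lim: "\<And>z. (\<lambda>n. G n z) \<longlonglongrightarrow> g z"
    and bd: "eventually (\<lambda>n. fock_norm (G n) \<le> e) sequentially"
  shows "g \<in> fock_space" "fock_norm g \<le> e"
proof -
  let ?u = "\<lambda>f z. ennreal ((cmod (f z))\<^sup>2 * exp (- (cmod z)\<^sup>2))"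
  have e0: "e \<ge> 0"
  proof -
    obtain n where "fock_norm (G n) \<le> e" using eventually_happens'[OF sequentially_bot bd] by blast
    then show ?thesis using fock_norm_nonneg[of "G n"] by linarith
  qed
  have cont: "continuous_on UNIV (\<lambda>z. (cmod (g z))\<^sup>2 * exp (- (cmod z)\<^sup>2))"
    by (intro continuous_intros holomorphic_on_imp_continuous_on assms)
  then have [measurable]: "(\<lambda>z. (cmod (g z))\<^sup>2 * exp (- (cmod z)\<^sup>2)) \<in> borel_measurable borel"
    by (rule borel_measurable_continuous_onI)
  have "(\<integral>\<^sup>+z. ?u g z \<partial>lborel) = (\<integral>\<^sup>+z. liminf (\<lambda>n. ?u (G n) z) \<partial>lborel)"
  proof (rule nn_integral_cong)
    fix z
    have "(\<lambda>n. ?u (G n) z) \<longlonglongrightarrow> ?u g z" by (intro tendsto_intros tendsto_ennrealI lim)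
    then show "?u g z = liminf (\<lambda>n. ?u (G n) z)"
      by (rule lim_imp_Liminf[OF sequentially_bot, symmetric])
  qed
  also have "\<dots> \<le> liminf (\<lambda>n. \<integral>\<^sup>+z. ?u (G n) z \<partial>lborel)"
    using assms(1)[THEN fock_space_measurable] by (intro nn_integral_liminf) auto
  also have "\<dots> \<le> liminf (\<lambda>n::nat. ennreal (pi * e\<^sup>2))"
  proof (rule Liminf_mono)
    show "\<forall>\<^sub>F n in sequentially. (\<integral>\<^sup>+z. ?u (G n) z \<partial>lborel) \<le> ennreal (pi * e\<^sup>2)"
      using bd by eventually_elim
        (auto simp: nn_integral_fock_norm assms(1) intro!: ennreal_leI mult_left_mono power_mono fock_norm_nonneg)
  qed
  finally have le: "(\<integral>\<^sup>+z. ?u g z \<partial>lborel) \<le> ennreal (pi * e\<^sup>2)" by (simp add: Liminf_const)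
  then have "integrable lborel (\<lambda>z. (cmod (g z))\<^sup>2 * exp (- (cmod z)\<^sup>2))"
    by (intro integrableI_bounded) (auto intro: le_less_trans simp: ennreal_less_top)
  then show g: "g \<in> fock_space" using assms(2) by (simp add: fock_space_iff)
  have "(fock_norm g)\<^sup>2 \<le> e\<^sup>2"
    using le e0 by (simp add: nn_integral_fock_norm[OF g] ennreal_le_iff)
  then show "fock_norm g \<le> e" using e0 by (rule power2_le_imp_le)
qed

text \<open>By the pointwise bound a Cauchy sequence converges locally uniformly, so its limit
  \<open>f\<close> is entire. Fatou applied to \<open>F n - F m\<close> with \<open>m\<close>
  tending to infinity puts \<open>F n - f\<close> into the space and bounds its norm.\<close>

instance fock :: complete_space
proof
  fix X :: "nat \<Rightarrow> fock" assume "Cauchy X"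
  define F where "F n = fock_fun (X n)" for n
  have F: "F n \<in> fock_space" for n by (simp add: F_def)
  have FD: "fock_norm (\<lambda>z. F n z - F m z) = norm (X n - X m)" for m n
    by (simp add: F_def norm_fock.rep_eq minus_fock.rep_eq)
  have C: "\<exists>N. \<forall>m\<ge>N. \<forall>n\<ge>N. norm (X m - X n) < e" if "e > 0" for e
    using \<open>Cauchy X\<close> that by (auto simp: Cauchy_iff)
  have pw: "cmod (F n z - F m z) \<le> norm (X n - X m) * exp ((cmod z)\<^sup>2 / 2)" for m n z
    using fock_pointwise_le[OF fock_space_diff[OF F F]] by (simp add: FD)
  have "Cauchy (\<lambda>n. F n z)" for z
  proof (rule CauchyI)
    fix e :: real assume "e > 0"
    then obtain N where N: "\<forall>m\<ge>N. \<forall>n\<ge>N. norm (X m - X n) < e / exp ((cmod z)\<^sup>2 / 2)"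
      using C[of "e / exp ((cmod z)\<^sup>2 / 2)"] by auto
    have "cmod (F m z - F n z) < e" if "m \<ge> N" "n \<ge> N" for m n
    proof -
      have "norm (X m - X n) * exp ((cmod z)\<^sup>2 / 2) < e"
        using N that by (simp add: pos_less_divide_eq)
      then show ?thesis using pw[of m z n] by linarith
    qed
    then show "\<exists>M. \<forall>m\<ge>M. \<forall>n\<ge>M. cmod (F m z - F n z) < e" by blast
  qed
  then obtain f where f: "\<And>z. (\<lambda>n. F n z) \<longlonglongrightarrow> f z"
    unfolding Cauchy_convergent_iff convergent_def by metis
  have near: "cmod (F n z - f z) \<le> e * exp ((cmod z)\<^sup>2 / 2)"
    if N: "\<forall>m\<ge>N. \<forall>n\<ge>N. norm (X m - X n) < e" and "n \<ge> N" for e N n z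
  proof (rule LIMSEQ_le_const2)
    show "(\<lambda>m. cmod (F n z - F m z)) \<longlonglongrightarrow> cmod (F n z - f z)" by (intro tendsto_intros f)
    have "cmod (F n z - F m z) \<le> e * exp ((cmod z)\<^sup>2 / 2)" if "m \<ge> N" for m
      using pw[of n z m] mult_right_mono[of "norm (X n - X m)" e "exp ((cmod z)\<^sup>2 / 2)"] N that \<open>n \<ge> N\<close>
      by (smt (verit) exp_ge_zero)
    then show "\<exists>M. \<forall>m\<ge>M. cmod (F n z - F m z) \<le> e * exp ((cmod z)\<^sup>2 / 2)" by blast
  qed
  have holf: "f holomorphic_on UNIV"
  proof (rule holomorphic_uniform_sequence[of UNIV F])
    show "F n holomorphic_on UNIV" for n by (rule fock_space_holomorphic[OF F])
    fix x :: complex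
    have "uniform_limit (cball x 1) F f sequentially"
    proof (rule uniform_limitI)
      fix e :: real assume e: "e > 0"
      define R where "R = exp ((cmod x + 1)\<^sup>2 / 2)"
      have R: "R > 0" by (simp add: R_def)
      obtain N where N: "\<forall>m\<ge>N. \<forall>n\<ge>N. norm (X m - X n) < e / (2 * R)"
        using C[of "e / (2 * R)"] e R by auto
      have "dist (F n y) (f y) < e" if "n \<ge> N" "y \<in> cball x 1" for n y
      proof -
        have "cmod y \<le> cmod x + 1"
          using that(2) norm_triangle_ineq[of x "y - x"] by (simp add: dist_norm norm_minus_commute)
        then have "exp ((cmod y)\<^sup>2 / 2) \<le> R" unfolding R_def by (simp add: power_mono)
        then have "e / (2 * R) * exp ((cmod y)\<^sup>2 / 2) \<le> e / (2 * R) * R"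
          using e R by (intro mult_left_mono) auto
        also have "\<dots> < e" using e R by simp
        finally show ?thesis using near[OF N that(1), of y] by (simp add: dist_norm)
      qed
      then show "\<forall>\<^sub>F n in sequentially. \<forall>y\<in>cball x 1. dist (F n y) (f y) < e"
        unfolding eventually_sequentially by blast
    qed
    then show "\<exists>d>0. cball x d \<subseteq> UNIV \<and> uniform_limit (cball x d) F f sequentially"
      by (intro exI[of _ 1]) auto
  qed simp
  have conv: "(\<lambda>z. F n z - f z) \<in> fock_space \<and> fock_norm (\<lambda>z. F n z - f z) \<le> e"
    if N: "\<forall>m\<ge>N. \<forall>n\<ge>N. norm (X m - X n) < e" and "n \<ge> N" for e N n
  proof -
    have ev: "\<forall>\<^sub>F m in sequentially. fock_norm (\<lambda>z. F n z - F m z) \<le> e"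
      unfolding eventually_sequentially FD using N \<open>n \<ge> N\<close> less_imp_le by blast
    have "(\<lambda>z. F n z - f z) holomorphic_on UNIV"
      by (intro holomorphic_intros holf fock_space_holomorphic[OF F])
    moreover have "(\<lambda>m. F n z - F m z) \<longlonglongrightarrow> F n z - f z" for z by (intro tendsto_intros f)
    ultimately show ?thesis using fock_Fatou[OF fock_space_diff[OF F F] _ _ ev] by blast
  qed
  obtain N where "\<forall>m\<ge>N. \<forall>n\<ge>N. norm (X m - X n) < 1" using C[of 1] by auto
  then have "(\<lambda>z. F N z - f z) \<in> fock_space" using conv by blast
  \<comment> \<open>\<open>f\<close> is recovered as \<open>F N - (F N - f)\<close>.\<close>
  from fock_space_diff[OF F[of N] this] have fF: "f \<in> fock_space" by simp
  have "X \<longlonglongrightarrow> Fock f"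
  proof (rule metric_LIMSEQ_I)
    fix e :: real assume "e > 0"
    then obtain N where N: "\<forall>m\<ge>N. \<forall>n\<ge>N. norm (X m - X n) < e / 2" using C[of "e/2"] by auto
    have "dist (X n) (Fock f) < e" if "n \<ge> N" for n
    proof -
      have "dist (X n) (Fock f) = fock_norm (\<lambda>z. F n z - f z)"
        by (simp add: dist_norm norm_fock.rep_eq minus_fock.rep_eq F_def fF)
      then show ?thesis using conv[OF N that] \<open>e > 0\<close> by linarith
    qed
    then show "\<exists>N. \<forall>n\<ge>N. dist (X n) (Fock f) < e" by blast
  qed
  then show "convergent X" by (auto simp: convergent_def)
qed

lemma bounded_linear_fock_fun: "bounded_linear (\<lambda>x. fock_fun x z)"
proof (rule bounded_linear_intro)
  show "cmod (fock_fun x z) \<le> norm x * exp ((cmod z)\<^sup>2 / 2)" for x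
    using fock_pointwise_le[of "fock_fun x" z] by (simp add: norm_fock.rep_eq)
qed (simp_all add: scaleR_conv_of_real)

lemmas continuous_on_fock_fun [continuous_intros] = bounded_linear.continuous_on[OF bounded_linear_fock_fun]

section \<open>The functional equation\<close>

text \<open>Comparing derivatives at 0 of order \<open>n\<close> gives
  \<open>(1 + c * a ^ n) * (deriv ^^ n) G 0 = 0\<close>. The first factor is positive, so all Taylor
  coefficients vanish.\<close>

lemma entire_dilation_equation_trivial:
  fixes G :: "complex \<Rightarrow> complex"
  assumes hol: "G holomorphic_on UNIV" and "c > 0" "a \<ge> 0"
    and eq: "\<And>v. G v = - of_real c * G (of_real a * v)"
  shows "G v = 0"
proof (rule holomorphic_fun_eq_0_on_connected[OF hol])
  fix n
  have "(\<lambda>v. G (of_real a * v)) holomorphic_on UNIV"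
    by (rule holomorphic_on_compose_UNIV[OF hol]) (intro holomorphic_intros)
  then have "(deriv ^^ n) (\<lambda>v. - of_real c * G (of_real a * v)) 0 = - of_real c * (deriv ^^ n) (\<lambda>v. G (of_real a * v)) 0"
    by (rule higher_deriv_cmult) auto
  moreover have "(deriv ^^ n) (\<lambda>v. G (of_real a * v)) 0 = of_real a ^ n * (deriv ^^ n) G 0"
    using higher_deriv_compose_linear[OF hol, of UNIV 0 "of_real a" n] by simp
  moreover have "(\<lambda>v. - of_real c * G (of_real a * v)) = G" by (rule ext) (rule eq[symmetric])
  ultimately have "(deriv ^^ n) G 0 = - of_real c * (of_real a ^ n * (deriv ^^ n) G 0)" by metis
  then have "(deriv ^^ n) G 0 - (- of_real c * (of_real a ^ n * (deriv ^^ n) G 0)) = 0"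
    by (rule eq_iff_diff_eq_0[THEN iffD1])
  then have "of_real (1 + c * a ^ n) * (deriv ^^ n) G 0 = 0"
    by (simp add: distrib_right mult.assoc)
  moreover have "1 + c * a ^ n > 0" using assms by (simp add: add_pos_nonneg)
  ultimately show "(deriv ^^ n) G 0 = 0" by (metis less_irrefl mult_eq_0_iff of_real_eq_0_iff)
qed auto

text \<open>The modulus of \<open>G\<close> has period 1, so the bound on the strip is global. By
  Liouville \<open>G\<close> is constant, and a constant equal to its negative is 0.\<close>

lemma bounded_antiperiodic_entire_trivial:
  fixes G :: "complex \<Rightarrow> complex"
  assumes hol: "G holomorphic_on UNIV"
    and anti: "\<And>s. G (s + 1) = - G s"
    and bd: "\<And>s. 0 \<le> Re s \<Longrightarrow> Re s \<le> 1 \<Longrightarrow> cmod (G s) \<le> M"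
  shows "G s = 0"
proof -
  have per: "cmod (G (s + of_nat n)) = cmod (G s)" for s n
  proof (induction n)
    case (Suc n)
    have "G (s + of_nat (Suc n)) = - G (s + of_nat n)" using anti[of "s + of_nat n"] by (simp add: algebra_simps)
    then show ?case using Suc by simp
  qed simp
  have "cmod (G s) \<le> M" for s
  proof (cases "0 \<le> \<lfloor>Re s\<rfloor>")
    case True
    define n where "n = nat \<lfloor>Re s\<rfloor>"
    have n: "real n = of_int \<lfloor>Re s\<rfloor>" using True by (simp add: n_def)
    have "cmod (G (s - of_nat n)) \<le> M" by (rule bd; simp add: n; linarith)
    then show ?thesis using per[of "s - of_nat n" n] by simp
  next
    case False
    define n where "n = nat (- \<lfloor>Re s\<rfloor>)"
    have n: "real n = - of_int \<lfloor>Re s\<rfloor>" using False by (simp add: n_def)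
    have "cmod (G (s + of_nat n)) \<le> M" by (rule bd; simp add: n; linarith)
    then show ?thesis using per[of s n] by simp
  qed
  then have "bounded (range G)" by (auto simp: bounded_iff)
  with hol obtain k where k: "\<And>z. G z = k" using Liouville_theorem by (auto simp: constant_on_def)
  then have "k = - k" using anti[of 0] by simp
  then show ?thesis using k by simp
qed

text \<open>For \<open>a \<noteq> 1\<close> the map \<open>u \<mapsto> a * u + E\<close> has a fixed
  point, and recentring there leaves a pure dilation equation. For \<open>a = 1\<close> and
  \<open>E \<noteq> 0\<close> it is a translation; a Gaussian factor makes \<open>f\<close>
  antiperiodic, and the growth bound of the Fock space makes the product bounded on a strip.\<close>

lemma fock_functional_equation_trivial:
  assumes f: "f \<in> fock_space" and c: "c > 0" and a: "a \<ge> 0"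
    and eq: "\<And>u. f u = - of_real c * exp (cnj E * u) * f (of_real a * u + E)"
  shows "f u = 0"
proof (cases "a = 1")
  case False
  define p where "p = E / of_real (1 - a)"
  \<comment> \<open>Chosen so that conjugating with \<open>exp (- \<mu> * v)\<close> removes the
    exponential factor; see the equation \<open>mu\<close> below.\<close>
  define \<mu> where "\<mu> = cnj E / of_real (1 - a)"
  have a1: "complex_of_real (1 - a) \<noteq> 0" using False by (simp only: of_real_eq_0_iff)
  have fixp: "of_real a * p + E = p"
  proof -
    have "of_real (1 - a) * p = E" using a1 by (simp add: p_def)
    then show ?thesis by (simp add: algebra_simps)
  qed
  have mu: "- \<mu> + cnj E = - of_real a * \<mu>"
  proof -
    have "of_real (1 - a) * \<mu> = cnj E" using a1 by (simp add: \<mu>_def)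
    then show ?thesis by (simp add: algebra_simps)
  qed
  \<comment> \<open>The constant stays real and positive after recentring, since
    \<open>cnj E * p\<close> is real.\<close>
  define c' where "c' = c * exp ((cmod E)\<^sup>2 / (1 - a))"
  have c': "complex_of_real c' = of_real c * exp (cnj E * p)"
  proof -
    have "complex_of_real ((cmod E)\<^sup>2 / (1 - a)) = cnj E * p"
      unfolding p_def of_real_divide complex_norm_square by simp
    then show ?thesis by (simp add: c'_def flip: exp_of_real)
  qed
  define G where "G = (\<lambda>v. exp (- \<mu> * v) * f (p + v))"
  have "G (u - p) = 0"
  proof (rule entire_dilation_equation_trivial[of G c' a])
    have "(\<lambda>v. f (p + v)) holomorphic_on UNIV"
      by (rule holomorphic_on_compose_UNIV[OF fock_space_holomorphic[OF f]]) (intro holomorphic_intros)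
    then show "G holomorphic_on UNIV" unfolding G_def by (intro holomorphic_intros)
    show "c' > 0" using c by (simp add: c'_def)
    show "a \<ge> 0" by (rule a)
    fix v
    have arg: "of_real a * (p + v) + E = p + of_real a * v" using fixp by (simp add: algebra_simps)
    have "f (p + v) = - of_real c * exp (cnj E * p + cnj E * v) * f (p + of_real a * v)"
      using eq[of "p + v"] unfolding arg by (simp only: distrib_left)
    then have "G v = - (of_real c * exp (cnj E * p)) * exp (- \<mu> * v + cnj E * v) * f (p + of_real a * v)"
      unfolding exp_add G_def by (simp only: mult.assoc mult.left_commute mult_minus_left mult_minus_right)
    also have "- \<mu> * v + cnj E * v = - \<mu> * (of_real a * v)"
      using mu by (metis distrib_right mult.assoc mult.commute mult_minus_left)
    finally show "G v = - of_real c' * G (of_real a * v)" by (simp add: G_def c' mult.assoc)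
  qed
  then show ?thesis by (simp add: G_def)
next
  case True
  show ?thesis
  proof (cases "E = 0")
    assume "E = 0"
    then have "f u = - (of_real c * f u)"
      using eq[of u] True by (simp only: complex_cnj_zero mult_zero_left exp_zero of_real_1 mult_1 add_0_right mult_1_right mult_minus_left)
    then have "of_real (1 + c) * f u = 0"
      unfolding of_real_add of_real_1 distrib_right mult_1 by (metis add.left_inverse)
    moreover have "1 + c \<noteq> 0" using c by simp
    ultimately show ?thesis by (metis mult_eq_0_iff of_real_eq_0_iff)
  next
    assume E: "E \<noteq> 0"
    define b where "b = (cmod E)\<^sup>2"
    define l where "l = b / 2 - ln c"
    have b: "complex_of_real b = E * cnj E" unfolding b_def by (rule complex_norm_square)
    \<comment> \<open>Passing from \<open>s\<close> to \<open>s + 1\<close> adds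
      \<open>b * s + b / 2 - l\<close> to the exponent. Since \<open>b / 2 - l = ln c\<close>, this
      cancels both the exponential factor and \<open>c\<close>, leaving only the sign.\<close>
    define G where "G = (\<lambda>s. f (E * s) * exp (of_real b * s\<^sup>2 / 2 - of_real l * s))"
    have "G (u / E) = 0"
    proof (rule bounded_antiperiodic_entire_trivial[of G "fock_norm f * exp (b + \<bar>l\<bar>)"])
      have "(\<lambda>v. f (E * v)) holomorphic_on UNIV"
        by (rule holomorphic_on_compose_UNIV[OF fock_space_holomorphic[OF f]]) (intro holomorphic_intros)
      then show "G holomorphic_on UNIV" unfolding G_def by (intro holomorphic_intros) auto
    next
      fix s
      have "G s = - of_real c * exp (of_real b * s) * f (E * (s + 1)) * exp (of_real b * s\<^sup>2 / 2 - of_real l * s)"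
        using eq[of "E * s"] True unfolding G_def b by (simp add: algebra_simps)
      also have "complex_of_real c = exp (of_real (b / 2 - l))"
        unfolding exp_of_real using c by (simp add: l_def)
      also have "- exp (of_real (b / 2 - l)) * exp (of_real b * s) * f (E * (s + 1)) * exp (of_real b * s\<^sup>2 / 2 - of_real l * s)
          = - (f (E * (s + 1)) * exp (of_real (b / 2 - l) + of_real b * s + (of_real b * s\<^sup>2 / 2 - of_real l * s)))"
        unfolding exp_add by simp
      also have "of_real (b / 2 - l) + of_real b * s + (of_real b * s\<^sup>2 / 2 - of_real l * s)
          = of_real b * (s + 1)\<^sup>2 / 2 - of_real l * (s + 1)"
        by (simp add: power2_eq_square field_simps)
      finally show "G (s + 1) = - G s" by (simp add: G_def)
    next
      fix s :: complex assume s: "0 \<le> Re s" "Re s \<le> 1"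
      have "cmod (G s) = cmod (f (E * s)) * exp (Re (of_real b * s\<^sup>2 / 2 - of_real l * s))"
        by (simp add: G_def norm_mult)
      also have "\<dots> \<le> (fock_norm f * exp ((cmod (E * s))\<^sup>2 / 2)) * exp (Re (of_real b * s\<^sup>2 / 2 - of_real l * s))"
        by (intro mult_right_mono fock_pointwise_le f) simp
      also have "\<dots> = fock_norm f * exp ((cmod (E * s))\<^sup>2 / 2 + Re (of_real b * s\<^sup>2 / 2 - of_real l * s))"
        by (simp add: exp_add)
      \<comment> \<open>The squares of \<open>Im s\<close> cancel, so the bound depends on
        \<open>Re s\<close> alone and is uniform on the strip.\<close>
      also have "(cmod (E * s))\<^sup>2 / 2 + Re (of_real b * s\<^sup>2 / 2 - of_real l * s) = b * (Re s)\<^sup>2 - l * Re s"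
      proof -
        have "(cmod (E * s))\<^sup>2 = b * ((Re s)\<^sup>2 + (Im s)\<^sup>2)"
          by (simp add: norm_mult power_mult_distrib b_def cmod_power2[of s])
        then show ?thesis by (simp add: power2_eq_square[of s] power2_eq_square[of "Re s"] power2_eq_square[of "Im s"] field_simps)
      qed
      also have "fock_norm f * exp (b * (Re s)\<^sup>2 - l * Re s) \<le> fock_norm f * exp (b + \<bar>l\<bar>)"
      proof -
        have "b * (Re s)\<^sup>2 \<le> b" using s by (intro mult_left_le) (auto simp: b_def power_le_one)
        moreover have "- l * Re s \<le> \<bar>l\<bar> * 1"
          using s by (intro mult_mono) auto
        ultimately show ?thesis using fock_norm_nonneg[of f] by (intro mult_left_mono) auto
      qed
      finally show "cmod (G s) \<le> fock_norm f * exp (b + \<bar>l\<bar>)" .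
    qed
    then show ?thesis using E by (simp add: G_def)
  qed
qed

section \<open>Affine symbols with exponential weight\<close>

definition affine_map :: "complex \<Rightarrow> complex \<Rightarrow> complex \<Rightarrow> complex" where
  "affine_map A B z = A * z + B"

definition exp_weight :: "complex \<Rightarrow> complex \<Rightarrow> complex \<Rightarrow> complex" where
  "exp_weight C D z = C * exp (D * z)"

lemma wcomp_kernel:
  "wcomp_expr (exp_weight C D) (affine_map A B) (fock_kernel u)
    = (\<lambda>z. C * exp (cnj u * B) * fock_kernel (cnj A * u + cnj D) z)"
  by (simp add: fun_eq_iff wcomp_expr_def exp_weight_def affine_map_def fock_kernel_def distrib_left distrib_right exp_add mult_ac)

lemma wcomp_kernel_in_fock_space:
  "wcomp_expr (exp_weight C D) (affine_map A B) (fock_kernel u) \<in> fock_space"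
  unfolding wcomp_kernel by (intro fock_space_cmult fock_kernel_in_fock_space)

lemma fock_inner_kernel_left: "f \<in> fock_space \<Longrightarrow> fock_inner (fock_kernel z) f = cnj (f z)"
  by (metis cnj_fock_inner fock_inner_kernel)

text \<open>The operator sends a kernel to a multiple of a kernel, so the pairing is an evaluation
  of \<open>g\<close>. Its value shows the symbols that any adjoint must have: all constants are
  conjugated, and \<open>B\<close> and \<open>D\<close> change places.\<close>

lemma wcomp_adjoint_kernel:
  assumes "g \<in> fock_space"
  shows "fock_inner (wcomp_expr (exp_weight C D) (affine_map A B) (fock_kernel u)) g
    = cnj (wcomp_expr (exp_weight (cnj C) (cnj B)) (affine_map (cnj A) (cnj D)) g u)"
  unfolding wcomp_kernel fock_inner_cmult_left fock_inner_kernel_left[OF assms]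
  by (simp add: wcomp_expr_def exp_weight_def affine_map_def exp_cnj mult_ac)

lemma wcomp_adjoint_kernel_right:
  assumes "g \<in> fock_space"
  shows "fock_inner g (wcomp_expr (exp_weight C D) (affine_map A B) (fock_kernel u))
    = wcomp_expr (exp_weight (cnj C) (cnj B)) (affine_map (cnj A) (cnj D)) g u"
  using wcomp_adjoint_kernel[OF assms] by (metis cnj_fock_inner complex_cnj_cnj)

text \<open>As both components range over \<open>fock\<close>, this set is the graph of the maximal
  operator. It is an intersection of closed conditions, one for each point, because evaluations are
  continuous.\<close>

lemma wcomp_graph_closed:
  "closed {(x, y). fock_fun y = wcomp_expr \<psi> \<phi> (fock_fun x)}"
proof -
  have "{(x, y). fock_fun y = wcomp_expr \<psi> \<phi> (fock_fun x)}
      = (\<Inter>z. {p. fock_fun (snd p) z = \<psi> z * fock_fun (fst p) (\<phi> z)})"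
    by (auto simp: wcomp_expr_def fun_eq_iff)
  then show ?thesis by (simp only:) (intro closed_INT ballI closed_Collect_eq continuous_intros)
qed

lemma wcomp_graph_subspace:
  "subspace {(x, y). fock_fun y = wcomp_expr \<psi> \<phi> (fock_fun x)}"
  by (rule subspaceI) (auto simp: wcomp_expr_def fun_eq_iff zero_prod_def algebra_simps)

text \<open>A vector of the graph orthogonal to the graph over the kernel functions satisfies the functional
  equation above, so the kernel functions span a core.\<close>
lemma wcomp_kernels_core:
  fixes A B C D :: complex
  assumes "C \<noteq> 0"
  defines "W \<equiv> wcomp_expr (exp_weight C D) (affine_map A B)"
  shows "{(x, y). fock_fun y = W (fock_fun x)}
    \<subseteq> closure (span {(Fock (\<lambda>z. c * fock_kernel u z), Fock (\<lambda>z. c * W (fock_kernel u) z)) | c u. True})"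
proof (rule subset_closure_span_if_orthogonal_trivial)
  \<comment> \<open>All complex multiples are listed because \<open>span\<close> is the real
    span.\<close>
  let ?T = "{(Fock (\<lambda>z. c * fock_kernel u z), Fock (\<lambda>z. c * W (fock_kernel u) z)) | c u. True}"
  show "closed {(x, y). fock_fun y = W (fock_fun x)}" unfolding W_def by (rule wcomp_graph_closed)
  show "subspace {(x, y). fock_fun y = W (fock_fun x)}" unfolding W_def by (rule wcomp_graph_subspace)
  have WK: "W (fock_kernel u) \<in> fock_space" for u unfolding W_def by (rule wcomp_kernel_in_fock_space)
  note mem = fock_space_cmult[OF fock_kernel_in_fock_space] fock_space_cmult[OF WK]
  show "?T \<subseteq> {(x, y). fock_fun y = W (fock_fun x)}"
    by (auto simp: mem) (simp add: W_def wcomp_expr_def mult_ac)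
  fix v assume v: "v \<in> {(x, y). fock_fun y = W (fock_fun x)}" and orth: "\<And>t. t \<in> ?T \<Longrightarrow> v \<bullet> t = 0"
  obtain x y where xy: "v = (x, y)" by (cases v)
  define f where "f = fock_fun x"
  have f: "f \<in> fock_space" and y: "fock_fun y = W f" using v by (simp_all add: f_def xy)
  have Wf: "W f \<in> fock_space" using fock_fun_in[of y] by (simp add: y)
  have eq0: "f u + cnj (C * exp (cnj u * B)) * W f (cnj A * u + cnj D) = 0" for u
  proof -
    let ?w = "f u + cnj (C * exp (cnj u * B)) * W f (cnj A * u + cnj D)"
    have *: "Re (cnj c * ?w) = 0" for c
    proof -
      have "v \<bullet> (Fock (\<lambda>z. c * fock_kernel u z), Fock (\<lambda>z. c * W (fock_kernel u) z)) = 0"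
        by (rule orth) blast
      then have "Re (fock_inner f (\<lambda>z. c * fock_kernel u z)) + Re (fock_inner (W f) (\<lambda>z. c * W (fock_kernel u) z)) = 0"
        by (simp add: xy inner_prod_def inner_fock.rep_eq mem f_def y)
      moreover have "fock_inner f (\<lambda>z. c * fock_kernel u z) = cnj c * f u"
        by (simp only: fock_inner_cmult_right fock_inner_kernel[OF f])
      moreover have "fock_inner (W f) (\<lambda>z. c * W (fock_kernel u) z) = cnj c * (cnj (C * exp (cnj u * B)) * W f (cnj A * u + cnj D))"
        unfolding fock_inner_cmult_right W_def wcomp_kernel
        using fock_inner_kernel[OF Wf] by (simp only: W_def)
      ultimately show ?thesis by (simp add: distrib_left)
    qed
    show ?thesis using *[of 1] *[of \<i>] by (simp add: complex_eq_iff)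
  qed
  have "f u = 0" for u
  \<comment> \<open>The constants come from expanding \<open>W f (cnj A * u + cnj D)\<close> in
    \<open>eq0\<close>: the two affine maps compose to the slope \<open>A * cnj A\<close>, and the
    exponentials leave the positive factor \<open>exp (D * cnj D)\<close>.\<close>
  proof (rule fock_functional_equation_trivial[OF f, of "(cmod C)\<^sup>2 * exp ((cmod D)\<^sup>2)" "(cmod A)\<^sup>2" "B + A * cnj D"])
    show "(cmod C)\<^sup>2 * exp ((cmod D)\<^sup>2) > 0" using assms(1) by simp
    show "(cmod A)\<^sup>2 \<ge> 0" by simp
    fix u
    have "f u = - (cnj (C * exp (cnj u * B)) * W f (cnj A * u + cnj D))"
      using eq0[of u] by (simp add: add_eq_0_iff2)
    also have "\<dots> = - (C * cnj C) * (exp (u * cnj B) * exp (D * (cnj A * u + cnj D))) * f (A * (cnj A * u + cnj D) + B)"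
      by (simp add: W_def wcomp_expr_def exp_weight_def affine_map_def exp_cnj mult_ac)
    also have "exp (u * cnj B) * exp (D * (cnj A * u + cnj D)) = exp (D * cnj D) * exp (cnj (B + A * cnj D) * u)"
      by (simp add: exp_add[symmetric] algebra_simps)
    also have "A * (cnj A * u + cnj D) + B = of_real ((cmod A)\<^sup>2) * u + (B + A * cnj D)"
      unfolding complex_norm_square by (simp add: algebra_simps)
    also have "- (C * cnj C) * (exp (D * cnj D) * exp (cnj (B + A * cnj D) * u))
        = - of_real ((cmod C)\<^sup>2 * exp ((cmod D)\<^sup>2)) * exp (cnj (B + A * cnj D) * u)"
    proof -
      have "complex_of_real ((cmod C)\<^sup>2 * exp ((cmod D)\<^sup>2)) = C * cnj C * exp (D * cnj D)"
        unfolding of_real_mult exp_of_real[symmetric] complex_norm_square ..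
      then show ?thesis by (simp only: mult.assoc mult_minus_left)
    qed
    finally show "f u = - of_real ((cmod C)\<^sup>2 * exp ((cmod D)\<^sup>2)) * exp (cnj (B + A * cnj D) * u)
        * f (of_real ((cmod A)\<^sup>2) * u + (B + A * cnj D))" .
  qed
  then have "f = (\<lambda>z. 0)" by blast
  then have "x = 0" "y = 0"
    using y by (auto simp: f_def fun_eq_iff W_def wcomp_expr_def fock_fun_inject[symmetric])
  then show "v = 0" by (simp add: xy zero_prod_def)
qed

text \<open>The identity says that \<open>(- V g, g)\<close> is orthogonal to the graph of
  \<open>W\<close>. This is known on the kernels, and a closed hyperplane containing a core contains
  the whole graph.\<close>

lemma wcomp_inner_adjoint:
  fixes A B C D :: complex
  assumes "C \<noteq> 0"
  defines "W \<equiv> wcomp_expr (exp_weight C D) (affine_map A B)"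
    and "V \<equiv> wcomp_expr (exp_weight (cnj C) (cnj B)) (affine_map (cnj A) (cnj D))"
  assumes f: "f \<in> fock_space" "W f \<in> fock_space" and g: "g \<in> fock_space" "V g \<in> fock_space"
  shows "fock_inner (W f) g = fock_inner f (V g)"
proof -
  have WK: "W (fock_kernel u) \<in> fock_space" for u unfolding W_def by (rule wcomp_kernel_in_fock_space)
  note mem = fock_space_cmult[OF fock_kernel_in_fock_space] fock_space_cmult[OF WK]
    fock_space_cmult[OF g(1)] fock_space_cmult[OF g(2)]
  let ?T = "{(Fock (\<lambda>z. c * fock_kernel u z), Fock (\<lambda>z. c * W (fock_kernel u) z)) | c u. True}"
  have *: "Re (cnj c * (fock_inner (W f) g - fock_inner f (V g))) = 0" for c
  proof -
    define v where "v = (- Fock (\<lambda>z. c * V g z), Fock (\<lambda>z. c * g z))"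
    have "?T \<subseteq> {t. v \<bullet> t = 0}"
    proof clarsimp
      fix d u
      have "v \<bullet> (Fock (\<lambda>z. d * fock_kernel u z), Fock (\<lambda>z. d * W (fock_kernel u) z))
         = Re (fock_inner (\<lambda>z. c * g z) (\<lambda>z. d * W (fock_kernel u) z)) - Re (fock_inner (\<lambda>z. c * V g z) (\<lambda>z. d * fock_kernel u z))"
        by (simp add: v_def inner_prod_def inner_Fock mem)
      also have "\<dots> = 0"
        unfolding fock_inner_cmult_left fock_inner_cmult_right fock_inner_kernel[OF g(2)]
        unfolding W_def V_def wcomp_adjoint_kernel_right[OF g(1)] by simp
      finally show "v \<bullet> (Fock (\<lambda>z. d * fock_kernel u z), Fock (\<lambda>z. d * W (fock_kernel u) z)) = 0" .
    qed
    then have "span ?T \<subseteq> {t. v \<bullet> t = 0}" by (rule span_minimal) (rule subspace_hyperplane)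
    then have "closure (span ?T) \<subseteq> {t. v \<bullet> t = 0}" by (rule closure_minimal) (rule closed_hyperplane)
    moreover have "(Fock f, Fock (W f)) \<in> closure (span ?T)"
      using wcomp_kernels_core[OF assms(1), where A = A and B = B and D = D] f unfolding W_def by (auto simp: subset_iff)
    ultimately have "(Fock f, Fock (W f)) \<bullet> v = 0" by (subst inner_commute) auto
    then have "Re (fock_inner (W f) (\<lambda>z. c * g z)) - Re (fock_inner f (\<lambda>z. c * V g z)) = 0"
      by (simp add: v_def inner_prod_def inner_Fock mem f)
    then show ?thesis by (simp add: fock_inner_cmult_right right_diff_distrib)
  qed
  show ?thesis using *[of 1] *[of \<i>] by (simp add: complex_eq_iff)
qed

section \<open>The maximal operator: adjoint, closedness, density of the domain\<close>

lemma dom_wcomp_max: "f \<in> dom (wcomp_max \<psi> \<phi>) \<longleftrightarrow> f \<in> fock_space \<and> wcomp_expr \<psi> \<phi> f \<in> fock_space"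
  by (auto simp: wcomp_max_def dom_def)

lemma the_wcomp_max: "f \<in> dom (wcomp_max \<psi> \<phi>) \<Longrightarrow> the (wcomp_max \<psi> \<phi> f) = wcomp_expr \<psi> \<phi> f"
  by (auto simp: wcomp_max_def dom_def split: if_splits)

text \<open>Testing with kernels, which lie in the domain, determines \<open>h\<close> at every
  point. The converse is \<open>wcomp_inner_adjoint\<close>.\<close>

lemma adjoint_rel_wcomp_max:
  fixes A B C D :: complex
  assumes "C \<noteq> 0"
  defines "W \<equiv> wcomp_expr (exp_weight C D) (affine_map A B)"
    and "V \<equiv> wcomp_expr (exp_weight (cnj C) (cnj B)) (affine_map (cnj A) (cnj D))"
  shows "adjoint_rel (wcomp_max (exp_weight C D) (affine_map A B)) g h
    \<longleftrightarrow> g \<in> fock_space \<and> V g \<in> fock_space \<and> h = V g"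
proof
  assume adj: "adjoint_rel (wcomp_max (exp_weight C D) (affine_map A B)) g h"
  then have g: "g \<in> fock_space" and h: "h \<in> fock_space" by (auto simp: adjoint_rel_def)
  have "h u = V g u" for u
  proof -
    have K: "fock_kernel u \<in> dom (wcomp_max (exp_weight C D) (affine_map A B))"
      by (simp add: dom_wcomp_max fock_kernel_in_fock_space wcomp_kernel_in_fock_space)
    then have "fock_inner (W (fock_kernel u)) g = fock_inner (fock_kernel u) h"
      using adj unfolding adjoint_rel_def W_def by (metis the_wcomp_max)
    then have "cnj (V g u) = cnj (h u)"
      unfolding W_def V_def wcomp_adjoint_kernel[OF g] fock_inner_kernel_left[OF h] .
    then show ?thesis by simp
  qed
  then have "h = V g" by blast
  with g h show "g \<in> fock_space \<and> V g \<in> fock_space \<and> h = V g" by simp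
next
  assume "g \<in> fock_space \<and> V g \<in> fock_space \<and> h = V g"
  then show "adjoint_rel (wcomp_max (exp_weight C D) (affine_map A B)) g h"
    unfolding adjoint_rel_def V_def
    by (auto simp: the_wcomp_max dom_wcomp_max wcomp_inner_adjoint[OF assms(1)])
qed

lemma adjoint_wcomp_max:
  assumes "C \<noteq> 0"
  shows "adjoint_op (wcomp_max (exp_weight C D) (affine_map A B))
    = wcomp_max (exp_weight (cnj C) (cnj B)) (affine_map (cnj A) (cnj D))"
  by (rule ext) (auto simp: adjoint_op_def adjoint_rel_wcomp_max[OF assms] wcomp_max_def)

lemma fock_tendsto_pointwise:
  assumes "\<And>n. F n \<in> fock_space" "f \<in> fock_space" "fock_tendsto F f"
  shows "(\<lambda>n. F n z) \<longlonglongrightarrow> f z"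
proof (rule Lim_transform_bound[of "\<lambda>n. F n z - f z", THEN LIM_zero_cancel])
  show "\<forall>\<^sub>F n in sequentially. norm (F n z - f z) \<le> norm (fock_norm (\<lambda>z. F n z - f z) * exp ((cmod z)\<^sup>2 / 2))"
    using fock_pointwise_le[OF fock_space_diff[OF assms(1,2)]]
    by (intro always_eventually allI) (simp add: abs_mult fock_norm_nonneg)
  show "(\<lambda>n. fock_norm (\<lambda>z. F n z - f z) * exp ((cmod z)\<^sup>2 / 2)) \<longlonglongrightarrow> 0"
    using assms(3) unfolding fock_tendsto_def by (rule tendsto_mult_left_zero)
qed

text \<open>Norm limits are pointwise limits, and the expression
  \<open>\<psi> z * f (\<phi> z)\<close> respects pointwise limits in \<open>f\<close>, so the two
  limits agree.\<close>

lemma closed_op_wcomp_max: "closed_op (wcomp_max \<psi> \<phi>)"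
  unfolding closed_op_def
proof (intro allI impI, elim conjE)
  fix F f g
  assume F: "\<forall>n. F n \<in> dom (wcomp_max \<psi> \<phi>)" and f: "f \<in> fock_space" and g: "g \<in> fock_space"
    and Ff: "fock_tendsto F f" and Fg: "fock_tendsto (\<lambda>n. the (wcomp_max \<psi> \<phi> (F n))) g"
  have F1: "F n \<in> fock_space" and F2: "wcomp_expr \<psi> \<phi> (F n) \<in> fock_space" for n
    using F by (auto simp: dom_wcomp_max)
  have "fock_tendsto (\<lambda>n. wcomp_expr \<psi> \<phi> (F n)) g" using Fg F by (simp add: the_wcomp_max)
  then have "(\<lambda>n. wcomp_expr \<psi> \<phi> (F n) z) \<longlonglongrightarrow> g z" for z
    by (intro fock_tendsto_pointwise F2 g)
  moreover have "(\<lambda>n. wcomp_expr \<psi> \<phi> (F n) z) \<longlonglongrightarrow> wcomp_expr \<psi> \<phi> f z" for z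
    unfolding wcomp_expr_def by (intro tendsto_intros fock_tendsto_pointwise F1 f Ff)
  ultimately have "g = wcomp_expr \<psi> \<phi> f" using LIMSEQ_unique by blast
  with f g show "wcomp_max \<psi> \<phi> f = Some g" by (simp add: wcomp_max_def)
qed

text \<open>A vector orthogonal to all multiples of kernels vanishes at every point by the
  reproducing property.\<close>

lemma closure_span_kernels:
  "closure (span {Fock (\<lambda>z. c * fock_kernel u z) | c u. True}) = UNIV"
proof -
  have "UNIV \<subseteq> closure (span {Fock (\<lambda>z. c * fock_kernel u z) | c u. True})"
  proof (rule subset_closure_span_if_orthogonal_trivial)
    fix x :: fock
    assume orth: "\<And>t. t \<in> {Fock (\<lambda>z. c * fock_kernel u z) | c u. True} \<Longrightarrow> x \<bullet> t = 0"
    have "fock_fun x u = 0" for u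
    proof -
      have "Re (cnj c * fock_fun x u) = 0" for c
      proof -
        have "x \<bullet> Fock (\<lambda>z. c * fock_kernel u z) = 0" by (rule orth) blast
        then have "Re (fock_inner (fock_fun x) (\<lambda>z. c * fock_kernel u z)) = 0"
          by (simp add: inner_fock.rep_eq fock_space_cmult fock_kernel_in_fock_space)
        then show ?thesis by (simp only: fock_inner_cmult_right fock_inner_kernel[OF fock_fun_in])
      qed
      from this[of 1] this[of \<i>] show ?thesis by (simp add: complex_eq_iff)
    qed
    then show "x = 0" by (auto simp: fock_fun_inject[symmetric])
  qed auto
  then show ?thesis by blast
qed

lemma densely_defined_wcomp_max:
  assumes "\<And>u. wcomp_expr \<psi> \<phi> (fock_kernel u) \<in> fock_space"
  shows "densely_defined (wcomp_max \<psi> \<phi>)"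
  unfolding densely_defined_def
proof (intro ballI allI impI)
  fix f and e :: real assume f: "f \<in> fock_space" and "e > 0"
  define S where "S = {x. wcomp_expr \<psi> \<phi> (fock_fun x) \<in> fock_space}"
  have "subspace S"
  proof (rule subspaceI)
    show "0 \<in> S" by (simp add: S_def wcomp_expr_def fock_space_0)
    show "x + y \<in> S" if "x \<in> S" "y \<in> S" for x y
      using fock_space_add[of "wcomp_expr \<psi> \<phi> (fock_fun x)" "wcomp_expr \<psi> \<phi> (fock_fun y)"] that
      by (simp add: S_def wcomp_expr_def distrib_left)
    show "c *\<^sub>R x \<in> S" if "x \<in> S" for c x
      using fock_space_cmult[of "wcomp_expr \<psi> \<phi> (fock_fun x)" "of_real c"] that
      by (simp add: S_def wcomp_expr_def mult.left_commute)
  qed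
  moreover have "{Fock (\<lambda>z. c * fock_kernel u z) | c u. True} \<subseteq> S"
    using fock_space_cmult[OF assms]
    by (auto simp: S_def wcomp_expr_def fock_space_cmult fock_kernel_in_fock_space mult.left_commute)
  ultimately have "span {Fock (\<lambda>z. c * fock_kernel u z) | c u. True} \<subseteq> S"
    by (simp add: span_minimal)
  then have "Fock f \<in> closure S" using closure_span_kernels closure_mono by blast
  then obtain x where x: "x \<in> S" "dist x (Fock f) < e"
    using \<open>e > 0\<close> by (auto simp: closure_approachable)
  then have "fock_fun x \<in> dom (wcomp_max \<psi> \<phi>)" by (simp add: dom_wcomp_max S_def)
  moreover have "fock_norm (\<lambda>z. f z - fock_fun x z) < e"
    using x(2) f by (simp add: dist_norm norm_fock.rep_eq minus_fock.rep_eq fock_norm_diff_commute)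
  ultimately show "\<exists>g\<in>dom (wcomp_max \<psi> \<phi>). fock_norm (\<lambda>z. f z - g z) < e" by blast
qed

text \<open>For \<open>A \<noteq> 0\<close> the motion \<open>w = \<alpha> * z + \<beta>\<close> is
  determined by \<open>cnj A * w + cnj D = A * z + B\<close>, so both expressions evaluate
  \<open>f\<close> at the same point. The hypotheses are what makes the remaining exponential
  weights agree. For \<open>A = 0\<close> they give \<open>D = cnj B\<close>, and the identity
  motion suffices.\<close>

lemma wcomp_rigid_symmetry:
  fixes A B C D :: complex
  assumes H: "cnj B * (1 - A) = D * (1 - cnj A)" and BD: "cmod B = cmod D"
  obtains \<alpha> \<beta> where "cmod \<alpha> = 1"
    "\<And>f z. (cmod (wcomp_expr (exp_weight C D) (affine_map A B) f z))\<^sup>2 * exp (- (cmod z)\<^sup>2)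
       = (cmod (wcomp_expr (exp_weight (cnj C) (cnj B)) (affine_map (cnj A) (cnj D)) f (\<alpha> * z + \<beta>)))\<^sup>2
          * exp (- (cmod (\<alpha> * z + \<beta>))\<^sup>2)"
proof (cases "A = 0")
  case True
  then have "D = cnj B" using H by simp
  with True show thesis
    by (intro that[of 1 0]) (simp_all add: wcomp_expr_def exp_weight_def affine_map_def norm_mult)
next
  case False
  define \<alpha> where "\<alpha> = A / cnj A"
  define \<beta> where "\<beta> = (B - cnj D) / cnj A"
  have "cmod \<alpha> = 1" using False by (simp add: \<alpha>_def norm_divide)
  moreover have "(cmod (wcomp_expr (exp_weight C D) (affine_map A B) f z))\<^sup>2 * exp (- (cmod z)\<^sup>2)
       = (cmod (wcomp_expr (exp_weight (cnj C) (cnj B)) (affine_map (cnj A) (cnj D)) f (\<alpha> * z + \<beta>)))\<^sup>2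
          * exp (- (cmod (\<alpha> * z + \<beta>))\<^sup>2)" for f z
  proof -
    define w where "w = \<alpha> * z + \<beta>"
    have w: "cnj A * w = A * z + B - cnj D" using False by (simp add: w_def \<alpha>_def \<beta>_def field_simps)
    have expo: "2 * Re (D * z) - (cmod z)\<^sup>2 = 2 * Re (cnj B * w) - (cmod w)\<^sup>2"
    proof -
      \<comment> \<open>The \<open>algebra\<close> method treats a variable and its conjugate as
        independent, so the conjugated equations are supplied too. The factor
        \<open>A * cnj A\<close> is cancelled at the end.\<close>
      have w': "A * cnj w = cnj A * cnj z + cnj B - D" using arg_cong[OF w, of cnj] by simp
      have H': "B * (1 - cnj A) = cnj D * (1 - A)" using arg_cong[OF H, of cnj] by simp
      have BD': "B * cnj B = D * cnj D" using BD by (metis complex_norm_square)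
      have "(A * cnj A) * (D * z + cnj D * cnj z - z * cnj z)
          = A * cnj B * (A * z + B - cnj D) + cnj A * B * (cnj A * cnj z + cnj B - D)
            - (A * z + B - cnj D) * (cnj A * cnj z + cnj B - D)"
        using H H' BD' by algebra
      also have "\<dots> = (A * cnj A) * (cnj B * w + B * cnj w - w * cnj w)"
        unfolding w[symmetric] w'[symmetric] by (simp add: algebra_simps)
      finally have "D * z + cnj D * cnj z - z * cnj z = cnj B * w + B * cnj w - w * cnj w"
        using False by simp
      then have "Re (D * z + cnj (D * z) - z * cnj z) = Re (cnj B * w + cnj (cnj B * w) - w * cnj w)" by simp
      then show ?thesis unfolding complex_norm_square[symmetric] by simp
    qed
    have form: "(cmod (c * exp x * y))\<^sup>2 * exp (- r) = (cmod c * cmod y)\<^sup>2 * exp (2 * Re x - r)" for c x y r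
      by (simp add: norm_mult power_mult_distrib exp_diff exp_minus field_simps flip: exp_double)
    have "cnj A * w + cnj D = A * z + B" using w by simp
    then show ?thesis
      unfolding w_def[symmetric] wcomp_expr_def exp_weight_def affine_map_def
      by (simp only: form expo complex_mod_cnj)
  qed
  ultimately show thesis by (rule that)
qed

lemma wcomp_holomorphic:
  assumes "f \<in> fock_space"
  shows "wcomp_expr (exp_weight C D) (affine_map A B) f holomorphic_on UNIV"
proof -
  have "(\<lambda>z. f (A * z + B)) holomorphic_on UNIV"
    by (rule holomorphic_on_compose_UNIV[OF fock_space_holomorphic[OF assms]]) (intro holomorphic_intros)
  then show ?thesis unfolding wcomp_expr_def exp_weight_def affine_map_def by (intro holomorphic_intros)
qed

text \<open>Rigid motions preserve Lebesgue measure, so the operator and its adjoint have the same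
  weighted square integrals, hence equal domains and equal norms.\<close>

lemma normal_wcomp_max:
  fixes A B C D :: complex
  assumes "C \<noteq> 0" and H: "cnj B * (1 - A) = D * (1 - cnj A)" and BD: "cmod B = cmod D"
  shows "normal_op (wcomp_max (exp_weight C D) (affine_map A B))"
proof -
  let ?W = "wcomp_expr (exp_weight C D) (affine_map A B)"
  let ?V = "wcomp_expr (exp_weight (cnj C) (cnj B)) (affine_map (cnj A) (cnj D))"
  obtain \<alpha> \<beta> where \<alpha>: "cmod \<alpha> = 1"
    and eq: "\<And>f z. (cmod (?W f z))\<^sup>2 * exp (- (cmod z)\<^sup>2) = (cmod (?V f (\<alpha> * z + \<beta>)))\<^sup>2 * exp (- (cmod (\<alpha> * z + \<beta>))\<^sup>2)"
    using wcomp_rigid_symmetry[OF H BD, of C] by blast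
  have meas: "(\<lambda>z. (cmod (?V f z))\<^sup>2 * exp (- (cmod z)\<^sup>2)) \<in> borel_measurable borel" if "f \<in> fock_space" for f
    by (intro borel_measurable_continuous_onI continuous_intros holomorphic_on_imp_continuous_on wcomp_holomorphic that)
  have mem: "?W f \<in> fock_space \<longleftrightarrow> ?V f \<in> fock_space" if f: "f \<in> fock_space" for f
    using lborel_integral_rigid(2)[OF \<alpha> meas[OF f], of \<beta>]
    by (simp add: fock_space_iff wcomp_holomorphic[OF f] eq)
  have norm: "fock_norm (?W f) = fock_norm (?V f)" if f: "f \<in> fock_space" for f
  proof -
    have "(fock_norm (?W f))\<^sup>2 = (fock_norm (?V f))\<^sup>2"
      unfolding fock_norm_square eq lborel_integral_rigid(1)[OF \<alpha> meas[OF f], of \<beta>] ..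
    then show ?thesis using fock_norm_nonneg power2_eq_imp_eq by blast
  qed
  show ?thesis
    unfolding normal_op_def adjoint_wcomp_max[OF assms(1)]
  proof (intro conjI ballI)
    show "closed_op (wcomp_max (exp_weight C D) (affine_map A B))" by (rule closed_op_wcomp_max)
    show "densely_defined (wcomp_max (exp_weight C D) (affine_map A B))"
      by (rule densely_defined_wcomp_max) (rule wcomp_kernel_in_fock_space)
    show "dom (wcomp_max (exp_weight C D) (affine_map A B))
        = dom (wcomp_max (exp_weight (cnj C) (cnj B)) (affine_map (cnj A) (cnj D)))"
      using mem by (auto simp: dom_wcomp_max set_eq_iff)
    fix f assume "f \<in> dom (wcomp_max (exp_weight C D) (affine_map A B))"
    then have "f \<in> fock_space" "?W f \<in> fock_space" by (simp_all add: dom_wcomp_max)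
    then show "fock_norm (the (wcomp_max (exp_weight C D) (affine_map A B) f))
        = fock_norm (the (wcomp_max (exp_weight (cnj C) (cnj B)) (affine_map (cnj A) (cnj D)) f))"
      using mem norm by (simp add: wcomp_max_def)
  qed
qed

section \<open>Symbols of normal weighted composition operators\<close>

text \<open>The difference \<open>k\<close> of two candidates is orthogonal to the domain. With
  \<open>f\<close> in the domain close to \<open>k\<close>, the square of its norm is the real part
  of \<open>fock_inner (k - f) k\<close>, which is arbitrarily small relative to the norm of
  \<open>k\<close>.\<close>

lemma adjoint_rel_unique:
  assumes dense: "densely_defined T" and sub: "dom T \<subseteq> fock_space"
    and adj: "adjoint_rel T g h" "adjoint_rel T g h'"
  shows "h = h'"
proof -
  define k where "k = (\<lambda>z. h z - h' z)"
  have h: "h \<in> fock_space" "h' \<in> fock_space" using adj by (auto simp: adjoint_rel_def)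
  then have k: "k \<in> fock_space" unfolding k_def by (rule fock_space_diff)
  have orth: "fock_inner f k = 0" if "f \<in> dom T" for f
  proof -
    have f: "f \<in> fock_space" using that sub by blast
    have "fock_inner f h = fock_inner f (\<lambda>z. k z + h' z)" by (simp add: k_def)
    also have "\<dots> = fock_inner f k + fock_inner f h'" by (rule fock_inner_add_right[OF k h(2) f])
    finally show ?thesis using adj that by (simp add: adjoint_rel_def)
  qed
  have "fock_norm k \<le> e" if e: "e > 0" for e
  proof -
    obtain f where f: "f \<in> dom T" "fock_norm (\<lambda>z. k z - f z) < e"
      using dense k e unfolding densely_defined_def by blast
    have fF: "f \<in> fock_space" using f sub by blast
    have "fock_inner k k = fock_inner (\<lambda>z. (k z - f z) + f z) k" by simp
    also have "\<dots> = fock_inner (\<lambda>z. k z - f z) k + fock_inner f k"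
      by (rule fock_inner_add_left[OF fock_space_diff[OF k fF] fF k])
    finally have "fock_inner k k = fock_inner (\<lambda>z. k z - f z) k" using orth[OF f(1)] by simp
    then have "(fock_norm k)\<^sup>2 = Re (fock_inner (\<lambda>z. k z - f z) k)"
      using Re_fock_inner_self_nonneg[of k] by (simp add: fock_norm_def)
    also have "\<dots> \<le> fock_norm (\<lambda>z. k z - f z) * fock_norm k"
      using fock_Cauchy_Schwarz[OF fock_space_diff[OF k fF] k] complex_Re_le_cmod order_trans by blast
    also have "\<dots> \<le> e * fock_norm k" using f(2) by (intro mult_right_mono fock_norm_nonneg) simp
    finally show ?thesis
      using fock_norm_nonneg[of k] that
      by (cases "fock_norm k = 0") (auto simp: power2_eq_square)
  qed
  then have "fock_norm k = 0" using fock_norm_nonneg[of k] by (meson dense_ge order_antisym)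
  then have "k z = 0" for z using fock_norm_eq_0[OF k] by blast
  then show ?thesis by (auto simp: k_def fun_eq_iff)
qed

lemma adjoint_op_eq_Some:
  assumes "densely_defined T" "dom T \<subseteq> fock_space" "adjoint_rel T g h"
  shows "adjoint_op T g = Some h"
proof -
  have "(THE h. adjoint_rel T g h) = h"
    using assms(3) adjoint_rel_unique[OF assms(1,2)] by blast
  then show ?thesis using assms(3) by (auto simp: adjoint_op_def)
qed

text \<open>For \<open>f\<close> in the domain, pairing \<open>W f\<close> with the kernel at
  \<open>z\<close> gives \<open>\<psi> z * f (\<phi> z)\<close>, again a pairing of \<open>f\<close>
  with a kernel. So the adjoint is explicit on kernels, and normality transfers membership and norm
  to \<open>W\<close> itself.\<close>

lemma normal_wcomp_kernel:
  assumes W: "W = wcomp_max \<psi> \<phi> |` S" "S \<subseteq> dom (wcomp_max \<psi> \<phi>)" and norm: "normal_op W"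
  shows "wcomp_expr \<psi> \<phi> (fock_kernel z) \<in> fock_space"
    and "fock_norm (wcomp_expr \<psi> \<phi> (fock_kernel z)) = cmod (\<psi> z) * exp ((cmod (\<phi> z))\<^sup>2 / 2)"
proof -
  have domW: "f \<in> fock_space" "wcomp_expr \<psi> \<phi> f \<in> fock_space" "the (W f) = wcomp_expr \<psi> \<phi> f" if "f \<in> dom W" for f
    using that W by (auto simp: wcomp_max_def restrict_map_def split: if_splits)
  have "adjoint_rel W (fock_kernel z) (\<lambda>w. cnj (\<psi> z) * fock_kernel (\<phi> z) w)"
    unfolding adjoint_rel_def
  proof (intro conjI ballI)
    fix f assume f: "f \<in> dom W"
    show "fock_inner (the (W f)) (fock_kernel z) = fock_inner f (\<lambda>w. cnj (\<psi> z) * fock_kernel (\<phi> z) w)"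
      using domW[OF f] by (simp add: fock_inner_kernel fock_inner_cmult_right) (simp add: wcomp_expr_def)
  qed (simp_all add: fock_kernel_in_fock_space fock_space_cmult)
  then have adj: "adjoint_op W (fock_kernel z) = Some (\<lambda>w. cnj (\<psi> z) * fock_kernel (\<phi> z) w)"
    using norm domW(1) by (intro adjoint_op_eq_Some) (auto simp: normal_op_def)
  then have K: "fock_kernel z \<in> dom W" using norm by (simp add: normal_op_def domI)
  show "wcomp_expr \<psi> \<phi> (fock_kernel z) \<in> fock_space" using domW(2)[OF K] .
  have "fock_norm (the (W (fock_kernel z))) = fock_norm (the (adjoint_op W (fock_kernel z)))"
    using norm K by (simp add: normal_op_def)
  then show "fock_norm (wcomp_expr \<psi> \<phi> (fock_kernel z)) = cmod (\<psi> z) * exp ((cmod (\<phi> z))\<^sup>2 / 2)"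
    by (simp add: domW(3)[OF K] adj fock_norm_cmult fock_norm_kernel)
qed

section \<open>Growth estimates forcing the symbols to be affine and exponential\<close>

lemma linear_coeff_nonpos:
  fixes a b :: real
  assumes "\<And>t. t > 0 \<Longrightarrow> a * t + b \<le> 0"
  shows "a \<le> 0"
proof (rule ccontr)
  assume "\<not> a \<le> 0"
  then have "a * ((\<bar>b\<bar> + 1) / a) + b > 0" "(\<bar>b\<bar> + 1) / a > 0" by (auto simp: add_pos_nonneg)
  then show False using assms by (meson not_less)
qed

lemma quadratic_coeff_nonpos:
  fixes a b c :: real
  assumes "\<And>t. t > 0 \<Longrightarrow> a * t\<^sup>2 + b * t + c \<le> 0"
  shows "a \<le> 0"
proof (rule linear_coeff_nonpos)
  fix t :: real assume "t > 0"
  \<comment> \<open>The shift keeps \<open>s \<ge> 1\<close>, so that after division by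
    \<open>s\<close> the constant term stays above \<open>- \<bar>c\<bar>\<close> and the linear
    lemma applies.\<close>
  define s where "s = t + 1"
  have s: "s \<ge> 1" "s > 0" using \<open>t > 0\<close> by (auto simp: s_def)
  have "a * s\<^sup>2 + b * s + c \<le> 0" using assms s by blast
  then have "(a * s\<^sup>2 + b * s + c) / s \<le> 0" using s by (simp add: divide_nonpos_pos)
  moreover have "(a * s\<^sup>2 + b * s + c) / s = a * s + b + c / s" using s by (simp add: field_simps power2_eq_square)
  moreover have "c / s \<ge> - \<bar>c\<bar>"
  proof -
    have "\<bar>c / s\<bar> \<le> \<bar>c\<bar>" using s mult_right_mono[of 1 s "\<bar>c\<bar>"] by (simp add: field_simps)
    then show ?thesis by linarith
  qed
  ultimately show "a * t + (a + b - \<bar>c\<bar>) \<le> 0" by (simp add: s_def algebra_simps)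
qed

text \<open>The Borel--Caratheodory argument: the Schwarz lemma applied to \<open>h / (2 M - h)\<close> with
  \<open>M\<close> bounding \<open>Re h\<close>.\<close>
lemma entire_Re_le_quadratic:
  assumes hol: "g holomorphic_on UNIV" and bd: "\<And>w. Re (g w) \<le> K + (cmod w)\<^sup>2 / 2"
  obtains a b c where "\<And>w. g w = a * w\<^sup>2 + b * w + c"
proof -
  define h where "h = (\<lambda>w. g w - g 0)"
  \<comment> \<open>The summand 1 makes the bound on \<open>Re (h w)\<close> strict and
    \<open>k\<close> positive.\<close>
  define k where "k = \<bar>K - Re (g 0)\<bar> + 1"
  have holh: "h holomorphic_on UNIV" unfolding h_def by (intro holomorphic_intros hol)
  have h0: "h 0 = 0" by (simp add: h_def)
  have hb: "Re (h w) < k + (cmod w)\<^sup>2 / 2" for w using bd[of w] by (simp add: h_def k_def)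
  have k: "k > 0" by (simp add: k_def)
  have bound: "cmod (h w) \<le> 2 * k + 4 * (cmod w)\<^sup>2" for w
  proof (cases "w = 0")
    case False
    \<comment> \<open>The disc of twice the radius puts \<open>w\<close> at modulus 1/2. The Schwarz
      lemma then gives \<open>cmod (H \<xi>) \<le> cmod (2 * M - H \<xi>) / 2\<close>, whence
      \<open>cmod (H \<xi>) \<le> 2 * M\<close>.\<close>
    define R where "R = 2 * cmod w"
    define M where "M = k + R\<^sup>2 / 2"
    have R: "R > 0" using False by (simp add: R_def)
    have M: "M > 0" using k by (simp add: M_def add_pos_nonneg)
    define H where "H = (\<lambda>\<xi>. h (of_real R * \<xi>))"
    have H: "Re (H \<xi>) < M" if "cmod \<xi> < 1" for \<xi>
    proof -
      have "(cmod (of_real R * \<xi>))\<^sup>2 \<le> R\<^sup>2"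
        using that R by (simp add: norm_mult power_mult_distrib mult_left_le power_le_one)
      then show ?thesis using hb[of "of_real R * \<xi>"] by (simp add: H_def M_def)
    qed
    define s where "s = (\<lambda>\<xi>. H \<xi> / (of_real (2 * M) - H \<xi>))"
    have nz: "of_real (2 * M) - H \<xi> \<noteq> 0" if "cmod \<xi> < 1" for \<xi>
    proof
      assume "of_real (2 * M) - H \<xi> = 0"
      then have "Re (H \<xi>) = 2 * M" by (simp add: complex_eq_iff)
      then show False using H[OF that] M by simp
    qed
    have lt: "cmod (H \<xi>) < cmod (of_real (2 * M) - H \<xi>)" if "cmod \<xi> < 1" for \<xi>
    proof -
      have "(cmod (of_real (2 * M) - H \<xi>))\<^sup>2 - (cmod (H \<xi>))\<^sup>2 = 4 * M * (M - Re (H \<xi>))"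
        unfolding cmod_power2 by (simp add: power2_eq_square algebra_simps)
      also have "\<dots> > 0" using M H[OF that] by simp
      finally have "(cmod (H \<xi>))\<^sup>2 < (cmod (of_real (2 * M) - H \<xi>))\<^sup>2" by simp
      then show ?thesis by (rule power_less_imp_less_base) simp
    qed
    define \<xi> where "\<xi> = w / of_real R"
    have \<xi>: "cmod \<xi> = 1 / 2" using False by (simp add: \<xi>_def R_def norm_divide)
    have "cmod (s \<xi>) \<le> cmod \<xi>"
    proof (rule Schwarz_Lemma(1))
      have "H holomorphic_on ball 0 1" unfolding H_def
        by (rule holomorphic_on_compose_UNIV[OF holh]) (intro holomorphic_intros)
      then show "s holomorphic_on ball 0 1" unfolding s_def using nz by (intro holomorphic_intros) auto
      show "s 0 = 0" by (simp add: s_def H_def h0)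
      show "cmod (s z) < 1" if "cmod z < 1" for z
        using lt[OF that] nz[OF that] by (simp add: s_def norm_divide)
    qed (simp add: \<xi>)
    then have "cmod (H \<xi>) \<le> cmod (of_real (2 * M) - H \<xi>) / 2"
      using nz[of \<xi>] \<xi> by (simp add: s_def norm_divide field_simps)
    also have "cmod (of_real (2 * M) - H \<xi>) \<le> 2 * M + cmod (H \<xi>)"
      using norm_triangle_ineq4[of "of_real (2 * M)" "H \<xi>"] M by simp
    finally have "cmod (H \<xi>) \<le> 2 * M" by simp
    moreover have "H \<xi> = h w" using R by (simp add: H_def \<xi>_def)
    ultimately show ?thesis by (simp add: M_def R_def power_mult_distrib)
  qed (use k h0 in simp)
  define d where "d i = (deriv ^^ i) h 0 / fact i" for i
  have h1: "h w = (\<Sum>i\<le>2. d i * w ^ i)" for w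
    unfolding d_def
  proof (rule Liouville_polynomial[OF holh])
    fix z assume "1 \<le> cmod z"
    then have "k * 1 \<le> k * (cmod z)\<^sup>2" using k by (intro mult_left_mono) auto
    then show "cmod (h z) \<le> (2 * k + 4) * (cmod z)\<^sup>2" using bound[of z] by (simp add: algebra_simps)
  qed
  have h2: "(\<Sum>i\<le>2. d i * w ^ i) = d 2 * w\<^sup>2 + d 1 * w + d 0" for w
    by (simp add: numeral_2_eq_2)
  have "g w = d 2 * w\<^sup>2 + d 1 * w + (d 0 + g 0)" for w
  proof -
    have "g w = h w + g 0" by (simp add: h_def)
    then show ?thesis unfolding h1 h2 add.assoc .
  qed
  then show thesis by (rule that)
qed

text \<open>With \<open>\<psi> = exp q\<close> the hypothesis bounds the real part of
  \<open>q + v * \<phi>\<close> quadratically for every constant \<open>v\<close>;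
  \<open>v = 0\<close> and \<open>v = 1\<close> make \<open>q\<close> and \<open>\<phi>\<close>
  quadratic polynomials. Both leading coefficients are then removed by letting \<open>z\<close> and
  \<open>w\<close> grow in suitable directions.\<close>

lemma affine_exp_weight_rigidity:
  assumes hol: "\<psi> holomorphic_on UNIV" "\<phi> holomorphic_on UNIV" and nz: "\<And>z. \<psi> z \<noteq> 0"
    and le: "\<And>z w. cmod (\<psi> w * exp (cnj z * \<phi> w)) \<le> cmod (\<psi> z) * exp ((cmod (\<phi> z))\<^sup>2 / 2) * exp ((cmod w)\<^sup>2 / 2)"
  obtains A B C D where "C \<noteq> 0" "\<psi> = exp_weight C D" "\<phi> = affine_map A B"
proof -
  obtain q where q: "q holomorphic_on UNIV" "\<And>z. \<psi> z = exp (q z)"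
    using contractible_imp_holomorphic_log[OF hol(1) contractible_UNIV nz] by (metis UNIV_I)
  have I: "Re (q w) + Re (cnj z * \<phi> w) \<le> Re (q z) + (cmod (\<phi> z))\<^sup>2 / 2 + (cmod w)\<^sup>2 / 2" for z w
  proof -
    have "exp (Re (q w) + Re (cnj z * \<phi> w)) \<le> exp (Re (q z) + (cmod (\<phi> z))\<^sup>2 / 2 + (cmod w)\<^sup>2 / 2)"
      using le[of w z] unfolding q(2) norm_mult norm_exp_eq_Re exp_add .
    then show ?thesis by simp
  qed
  have quad: "\<exists>a b c. \<forall>w. q w + v * \<phi> w = a * w\<^sup>2 + b * w + c" for v
  proof -
    have "(\<lambda>w. q w + v * \<phi> w) holomorphic_on UNIV" by (intro holomorphic_intros q hol)
    moreover have "Re (q w + v * \<phi> w) \<le> (Re (q (cnj v)) + (cmod (\<phi> (cnj v)))\<^sup>2 / 2) + (cmod w)\<^sup>2 / 2" for w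
      using I[of w "cnj v"] by simp
    ultimately show ?thesis by (rule entire_Re_le_quadratic) blast
  qed
  obtain q2 q1 q0 where qq: "\<And>w. q w = q2 * w\<^sup>2 + q1 * w + q0" using quad[of 0] by auto
  obtain p2 p1 p0 where pp: "\<And>w. q w + 1 * \<phi> w = p2 * w\<^sup>2 + p1 * w + p0" using quad[of 1] by blast
  have ph: "\<phi> w = (p2 - q2) * w\<^sup>2 + (p1 - q1) * w + (p0 - q0)" for w
  proof -
    have "\<phi> w = (p2 * w\<^sup>2 + p1 * w + p0) - q w" unfolding pp[symmetric] by simp
    then show ?thesis unfolding qq by (simp add: algebra_simps)
  qed
  have "p2 - q2 = 0"
  proof -
    define f where "f = p2 - q2"
    have "(cmod f)\<^sup>2 \<le> 0"
    \<comment> \<open>For fixed \<open>z\<close> and real \<open>w = t\<close> the leading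
      coefficient gives \<open>Re (q2 + cnj z * f) \<le> 1 / 2\<close>. The choice
      \<open>z = s * f\<close> makes the left side grow linearly in \<open>s\<close> unless
      \<open>f = 0\<close>.\<close>
    proof (rule linear_coeff_nonpos)
      fix s :: real assume "s > 0"
      let ?z = "of_real s * f"
      have "Re (q2 + cnj ?z * f) - 1 / 2 \<le> 0"
      proof (rule quadratic_coeff_nonpos)
        fix t :: real assume "t > 0"
        show "(Re (q2 + cnj ?z * f) - 1 / 2) * t\<^sup>2 + Re (q1 + cnj ?z * (p1 - q1)) * t
            + (Re (q0 + cnj ?z * (p0 - q0)) - Re (q ?z) - (cmod (\<phi> ?z))\<^sup>2 / 2) \<le> 0"
          using I[of "of_real t" ?z] unfolding qq[of "of_real t"] ph[of "of_real t"] f_def[symmetric]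
          by (simp add: algebra_simps power2_eq_square)
      qed
      moreover have "cnj ?z * f = of_real (s * (cmod f)\<^sup>2)"
        unfolding of_real_mult complex_norm_square by (simp add: mult_ac)
      then have "Re (cnj ?z * f) = s * (cmod f)\<^sup>2" by (simp only: Re_complex_of_real)
      ultimately show "(cmod f)\<^sup>2 * s + (Re q2 - 1 / 2) \<le> 0"
        unfolding plus_complex.sel by (simp add: mult.commute[of s])
    qed
    then show ?thesis by (simp add: f_def)
  qed
  define A where "A = p1 - q1"
  define B where "B = p0 - q0"
  have ph: "\<phi> w = A * w + B" for w using ph[of w] \<open>p2 - q2 = 0\<close> by (simp add: A_def B_def)
  \<comment> \<open>Scaling \<open>z\<close> and \<open>w\<close> together by \<open>t\<close>
    isolates the homogeneous quadratic part of \<open>I\<close>.\<close>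
  have II: "Re (q2 * w\<^sup>2) + Re (cnj z * A * w) - Re (q2 * z\<^sup>2) - (cmod (A * z))\<^sup>2 / 2 - (cmod w)\<^sup>2 / 2 \<le> 0" for z w
  proof (rule quadratic_coeff_nonpos)
    fix t :: real assume "t > 0"
    have e1: "Re (q (of_real t * u)) = Re (q2 * u\<^sup>2) * t\<^sup>2 + Re (q1 * u) * t + Re q0" for u
    proof -
      have "q (of_real t * u) = of_real (t\<^sup>2) * (q2 * u\<^sup>2) + of_real t * (q1 * u) + q0"
        by (simp add: qq power_mult_distrib)
      then show ?thesis by (simp only: plus_complex.sel Re_complex_of_real times_complex.sel Im_complex_of_real) simp
    qed
    have e2: "Re (cnj (of_real t * z) * \<phi> (of_real t * w)) = Re (cnj z * A * w) * t\<^sup>2 + Re (cnj z * B) * t"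
      by (simp add: ph power2_eq_square algebra_simps)
    have e3: "(cmod (\<phi> (of_real t * z)))\<^sup>2 = (cmod (A * z))\<^sup>2 * t\<^sup>2 + 2 * Re (A * z * cnj B) * t + (cmod B)\<^sup>2"
      unfolding ph cmod_power2 by (simp add: power2_eq_square algebra_simps)
    have e4: "(cmod (of_real t * w))\<^sup>2 = (cmod w)\<^sup>2 * t\<^sup>2" by (simp add: norm_mult power_mult_distrib)
    show "(Re (q2 * w\<^sup>2) + Re (cnj z * A * w) - Re (q2 * z\<^sup>2) - (cmod (A * z))\<^sup>2 / 2 - (cmod w)\<^sup>2 / 2) * t\<^sup>2
        + (Re (q1 * w) + Re (cnj z * B) - Re (q1 * z) - Re (A * z * cnj B)) * t + (- (cmod B)\<^sup>2 / 2) \<le> 0"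
      using I[of "of_real t * w" "of_real t * z"] unfolding e1 e2 e3 e4 by (simp add: field_simps del: times_complex.sel)
  qed
  have "q2 = 0"
  proof (rule ccontr)
    assume "q2 \<noteq> 0"
    \<comment> \<open>For \<open>w = cnj A * z\<close> the terms without \<open>q2\<close> cancel in
      \<open>II\<close>, leaving \<open>Re (\<kappa> * z\<^sup>2) \<le> 0\<close>. A square root of
      \<open>cnj \<kappa>\<close> as \<open>z\<close> turns this into
      \<open>(cmod \<kappa>)\<^sup>2 \<le> 0\<close>.\<close>
    define \<kappa> where "\<kappa> = q2 * ((cnj A)\<^sup>2 - 1)"
    define z where "z = csqrt (cnj \<kappa>)"
    have "Re (cnj z * A * (cnj A * z)) = (cmod (A * z))\<^sup>2"
    proof -
      have "cnj z * A * (cnj A * z) = (A * z) * cnj (A * z)" by simp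
      then show ?thesis unfolding complex_norm_square[symmetric] by (simp only: Re_complex_of_real)
    qed
    moreover have "(cmod (cnj A * z))\<^sup>2 = (cmod (A * z))\<^sup>2" by (simp add: norm_mult)
    ultimately have "Re (q2 * (cnj A * z)\<^sup>2) - Re (q2 * z\<^sup>2) \<le> 0"
      using II[of "cnj A * z" z] by simp
    then have "Re (\<kappa> * z\<^sup>2) \<le> 0" by (simp add: \<kappa>_def power_mult_distrib algebra_simps)
    also have "\<kappa> * z\<^sup>2 = of_real ((cmod \<kappa>)\<^sup>2)" unfolding complex_norm_square by (simp add: z_def)
    finally have "\<kappa> = 0" by simp
    then have "(cnj A)\<^sup>2 = 1" using \<open>q2 \<noteq> 0\<close> by (simp add: \<kappa>_def)
    then have "A\<^sup>2 = 1" by (metis complex_cnj_cnj complex_cnj_one complex_cnj_power)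
    then have A: "A * A = 1" "cmod A = 1"
      using power2_eq_1_iff[of A] by (auto simp: power2_eq_square)
    \<comment> \<open>Now \<open>A * A = 1\<close>. With \<open>w = A * (z + 1)\<close> the terms
      without \<open>q2\<close> amount to the constant -1/2, while those with \<open>q2\<close> grow
      linearly along \<open>z = s * cnj q2\<close>.\<close>
    have "(cmod q2)\<^sup>2 \<le> 0"
    proof (rule linear_coeff_nonpos)
      fix s :: real assume "s > 0"
      define z where "z = of_real s * cnj q2"
      have "cnj z * A * (A * (z + 1)) = cnj z * (A * A) * (z + 1)" by (simp only: mult.assoc)
      moreover have "(A * (z + 1))\<^sup>2 = (z + 1)\<^sup>2" "cmod (A * z) = cmod z" "cmod (A * (z + 1)) = cmod (z + 1)"
        using \<open>A\<^sup>2 = 1\<close> A by (simp_all add: power_mult_distrib norm_mult)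
      ultimately have "Re (q2 * (z + 1)\<^sup>2) + Re (cnj z * (z + 1)) - Re (q2 * z\<^sup>2) - (cmod z)\<^sup>2 / 2 - (cmod (z + 1))\<^sup>2 / 2 \<le> 0"
        using II[of "A * (z + 1)" z] by (simp only: A mult_1_right)
      moreover have "Re (cnj z * (z + 1)) - (cmod z)\<^sup>2 / 2 - (cmod (z + 1))\<^sup>2 / 2 = - 1 / 2"
        unfolding cmod_power2 by (simp add: power2_eq_square field_simps)
      moreover have "q2 * (z + 1)\<^sup>2 - q2 * z\<^sup>2 = (z * q2 + z * q2) + q2" by (simp add: power2_eq_square algebra_simps)
      then have "Re (q2 * (z + 1)\<^sup>2) - Re (q2 * z\<^sup>2) = Re (z * q2) + Re (z * q2) + Re q2"
        by (metis minus_complex.sel(1) plus_complex.sel(1))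
      moreover have "z * q2 = of_real (s * (cmod q2)\<^sup>2)"
        unfolding z_def of_real_mult complex_norm_square by (simp add: mult_ac)
      then have "Re (z * q2) = s * (cmod q2)\<^sup>2" by (simp only: Re_complex_of_real)
      ultimately show "(cmod q2)\<^sup>2 * s + (Re q2 / 2 - 1 / 4) \<le> 0" by (simp add: algebra_simps)
    qed
    then show False using \<open>q2 \<noteq> 0\<close> by simp
  qed
  show thesis
  proof (rule that)
    show "exp q0 \<noteq> 0" by simp
    show "\<psi> = exp_weight (exp q0) q1"
      by (simp add: fun_eq_iff exp_weight_def q(2) qq \<open>q2 = 0\<close> exp_add)
    show "\<phi> = affine_map A B" by (simp add: fun_eq_iff affine_map_def ph)
  qed
qed

section \<open>Relations between the constants and maximality\<close>

lemma fock_norm_wcomp_kernel: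
  "fock_norm (wcomp_expr (exp_weight C D) (affine_map A B) (fock_kernel z))
    = cmod C * exp (Re (cnj z * B) + (cmod (cnj A * z + cnj D))\<^sup>2 / 2)"
  unfolding wcomp_kernel fock_norm_cmult fock_norm_kernel exp_add by (simp add: norm_mult)

lemma Re_mult_eq_0_imp:
  assumes "\<And>z. Re (z * \<kappa>) = 0"
  shows "\<kappa> = 0"
  using assms[of 1] assms[of \<i>] by (simp add: complex_eq_iff)

text \<open>Taking logarithms of the norm identity compares two real quadratic polynomials in
  \<open>z\<close>. The quadratic parts agree, the value at 0 gives the moduli, and the linear part
  gives the other relation.\<close>

lemma normal_wcomp_coefficients:
  fixes A B C D :: complex
  assumes "C \<noteq> 0"
    and eq: "\<And>z. fock_norm (wcomp_expr (exp_weight C D) (affine_map A B) (fock_kernel z))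
        = cmod (exp_weight C D z) * exp ((cmod (affine_map A B z))\<^sup>2 / 2)"
  shows "cnj B * (1 - A) = D * (1 - cnj A)" "cmod B = cmod D"
proof -
  have E: "Re (cnj z * B) + (cmod (cnj A * z + cnj D))\<^sup>2 / 2 = Re (D * z) + (cmod (A * z + B))\<^sup>2 / 2" for z
  proof -
    have "cmod C * exp (Re (cnj z * B) + (cmod (cnj A * z + cnj D))\<^sup>2 / 2)
        = cmod C * exp (Re (D * z) + (cmod (A * z + B))\<^sup>2 / 2)"
      using eq[of z] unfolding fock_norm_wcomp_kernel exp_weight_def affine_map_def
      by (simp only: norm_mult norm_exp_eq_Re exp_add mult.assoc)
    then show ?thesis using assms(1) by simp
  qed
  have BD: "(cmod D)\<^sup>2 = (cmod B)\<^sup>2" using E[of 0] by simp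
  then show "cmod B = cmod D" by (simp add: power2_eq_iff_nonneg)
  have "Re (z * (cnj B + cnj A * D - D - A * cnj B)) = 0" for z
    using E[of z] BD unfolding cmod_power2 by (simp add: power2_eq_square field_simps)
  from Re_mult_eq_0_imp[OF this] show "cnj B * (1 - A) = D * (1 - cnj A)" by (simp add: algebra_simps)
qed

text \<open>Restricting an operator enlarges the domain of its adjoint. Hence the domain of
  \<open>T\<close>, being that of its adjoint, lies in the domain of the adjoint of
  \<open>W\<close>, which is the domain of \<open>W\<close>.\<close>

lemma normal_restriction_eq:
  assumes T: "W = T |` S" "S \<subseteq> dom T" and "normal_op W" "normal_op T"
  shows "W = T"
proof -
  have dW: "dom W = S" using T by auto
  have "dom T \<subseteq> dom (adjoint_op W)"
  proof
    fix g assume "g \<in> dom T"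
    then have "g \<in> dom (adjoint_op T)" using \<open>normal_op T\<close> by (simp add: normal_op_def)
    then obtain h where "adjoint_rel T g h" by (auto simp: adjoint_op_def split: if_splits)
    then have "adjoint_rel W g h" unfolding adjoint_rel_def dW using T by (auto simp: subset_iff)
    then show "g \<in> dom (adjoint_op W)" by (auto simp: adjoint_op_def dom_def)
  qed
  then have "dom T \<subseteq> S" using \<open>normal_op W\<close> dW by (simp add: normal_op_def)
  then show ?thesis using T by (auto simp: fun_eq_iff restrict_map_def dom_def)
qed

theorem theorem6p7:
  fixes \<psi> \<phi> :: "complex \<Rightarrow> complex" and W :: fock_op
  assumes "\<phi> holomorphic_on UNIV"
    and "\<psi> holomorphic_on UNIV"
    and "\<exists>z. \<psi> z \<noteq> 0"
    and "weighted_composition_op \<psi> \<phi> W"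
  shows "normal_op W \<longleftrightarrow>
    W = wcomp_max \<psi> \<phi> \<and>
    (\<exists>A B C D :: complex.
       ((\<forall>z. \<phi> z = A * z + B) \<and> A \<noteq> 1 \<and> (\<forall>z. \<psi> z = C * exp (D * z)) \<and>
          D = cnj B * (1 - A) * inverse (1 - cnj A)) \<or>
       ((\<forall>z. \<phi> z = z + B) \<and> (\<forall>z. \<psi> z = C * exp (D * z)) \<and> cmod D = cmod B))"
    (is "_ \<longleftrightarrow> _ \<and> (\<exists>A B C D. ?b A B C D)")
proof
  assume normal: "normal_op W"
  obtain S where S: "W = wcomp_max \<psi> \<phi> |` S" "S \<subseteq> dom (wcomp_max \<psi> \<phi>)"
    using assms(4) by (auto simp: weighted_composition_op_def)
  note ker = normal_wcomp_kernel[OF S normal]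
  \<comment> \<open>At a zero of \<psi> the norm formula would annihilate the image of the kernel;
    kernels have no zeros, so \<psi> would vanish identically.\<close>
  have nz: "\<psi> z \<noteq> 0" for z
  proof
    assume "\<psi> z = 0"
    then have "fock_norm (wcomp_expr \<psi> \<phi> (fock_kernel z)) = 0" by (simp add: ker(2))
    then have "\<psi> w * fock_kernel z (\<phi> w) = 0" for w
      using fock_norm_eq_0[OF ker(1)] by (simp add: wcomp_expr_def)
    then show False using assms(3) by (auto simp: fock_kernel_def)
  qed
  have le: "cmod (\<psi> w * exp (cnj z * \<phi> w)) \<le> cmod (\<psi> z) * exp ((cmod (\<phi> z))\<^sup>2 / 2) * exp ((cmod w)\<^sup>2 / 2)" for z w
    using fock_pointwise_le[OF ker(1), of z w] unfolding ker(2) by (simp add: wcomp_expr_def fock_kernel_def)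
  obtain A B C D where C: "C \<noteq> 0" and eq: "\<psi> = exp_weight C D" "\<phi> = affine_map A B"
    by (rule affine_exp_weight_rigidity[OF assms(2,1) nz le])
  note co = normal_wcomp_coefficients[OF C, OF ker(2)[unfolded eq]]
  have "W = wcomp_max \<psi> \<phi>"
    using normal_restriction_eq[OF S normal] normal_wcomp_max[OF C co] by (simp add: eq)
  moreover have "?b A B C D"
  proof (cases "A = 1")
    case True
    then show ?thesis using co(2) by (simp add: eq exp_weight_def affine_map_def)
  next
    case False
    then have "1 - cnj A \<noteq> 0" by (metis complex_cnj_cnj complex_cnj_one eq_iff_diff_eq_0)
    then have "D = cnj B * (1 - A) * inverse (1 - cnj A)" unfolding co(1) by simp
    then show ?thesis using False by (simp add: eq exp_weight_def affine_map_def)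
  qed
  ultimately show "W = wcomp_max \<psi> \<phi> \<and> (\<exists>A B C D. ?b A B C D)" by blast
next
  assume "W = wcomp_max \<psi> \<phi> \<and> (\<exists>A B C D. ?b A B C D)"
  then obtain A B C D where W: "W = wcomp_max \<psi> \<phi>" and b: "?b A B C D" by blast
  have \<psi>: "\<psi> = exp_weight C D" using b by (auto simp: fun_eq_iff exp_weight_def)
  have C: "C \<noteq> 0" using assms(3) by (auto simp: \<psi> exp_weight_def)
  \<comment> \<open>Case (ii) leaves \<open>A\<close> unconstrained, so the true slope gets its own
    name: 1 for a translation, \<open>A\<close> otherwise. A translation cannot also satisfy case
    (i), as evaluation at 1 shows.\<close>
  obtain A' where \<phi>: "\<phi> = affine_map A' B" and H: "cnj B * (1 - A') = D * (1 - cnj A')" "cmod B = cmod D"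
  proof (cases "\<forall>z. \<phi> z = z + B")
    case True
    show thesis
    proof (cases "A \<noteq> 1 \<and> (\<forall>z. \<phi> z = A * z + B)")
      case True
      with \<open>\<forall>z. \<phi> z = z + B\<close> have "A * 1 + B = 1 + B" by metis
      then show ?thesis using True by simp
    next
      case False
      then show ?thesis using b that[of 1] True by (auto simp: fun_eq_iff affine_map_def)
    qed
  next
    case False
    then have A: "A \<noteq> 1" and ph: "\<forall>z. \<phi> z = A * z + B" and D: "D = cnj B * (1 - A) * inverse (1 - cnj A)"
      using b by auto
    have ne: "1 - cnj A \<noteq> 0" using A by (metis complex_cnj_cnj complex_cnj_one eq_iff_diff_eq_0)
    \<comment> \<open>In case (i) the formula for \<open>D\<close> thus already contains the
      equality of moduli.\<close>
    have "cmod (1 - cnj A) = cmod (1 - A)" by (metis complex_cnj_diff complex_cnj_one complex_mod_cnj)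
    then have "cmod B = cmod D" using ne by (simp add: D norm_mult norm_inverse)
    then show thesis using ph ne by (intro that[of A]) (auto simp: fun_eq_iff affine_map_def D)
  qed
  show "normal_op W" unfolding W \<psi> \<phi> by (rule normal_wcomp_max[OF C H])
qed

end
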